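(* Let $X$ be a real Banach space which is convex-transitive with respect to $\mathcal{G}_X$ and has DES in some direction $f\in S_{X^*}$. Then $X$ is isomorphic to a Hilbert space. Moreover, if $X$ has $1$-DES in direction $f$, then $X$ is isometric to a Hilbert space.
   Context: All Banach spaces are real. $B_X$ and $S_X$ denote the closed unit ball and the unit sphere of $X$; $X^*$ is the dual space. "Isomorphic" means linearly homeomorphic; "isometric" means linearly isometric. $\mathcal{G}_X$ is the group of all linear isometries of $X$ onto itself. $X$ is convex-transitive with respect to $\mathcal{G}_X$ if $\overline{\mathrm{conv}}(\{Tx: T\in\mathcal{G}_X\})=B_X$ for all $x\in S_X$. An ellipsoid in a finite-dimensional space $E$ is a set $\{x\in E: (x|x)\le 1\}$, where $(\cdot|\cdot)$ is an inner product on $E$. For a finite-dimensional subspace $E\subset X$, $\mathcal{E}_E\subset E$ denotes the unique minimum volume (Lebesgue measure on $E$) ellipsoid containing $B_X\cap E$. For $f\in S_{X^*}$ put $\eta(f,E)=\max\{|f(y)|: y\in\mathcal{E}_E\}$. $X$ has Directionally Euclidean Structure (DES) in direction $f\in S_{X^*}$ if $\inf_F\sup_E\eta(f,E)<\infty$, where the infimum is over finite-dimensional subspaces $F\subset X$ and the supremum is over finite-dimensional subspaces $E\subset X$ with $F\subset E$. If this infimum equals $\lambda\in[1,\infty)$, then $X$ has $\lambda$-DES in direction $f$. *)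

theory Defs
  imports "HOL-Analysis.Analysis"
begin

definition isometry_group :: "('a::real_normed_vector \<Rightarrow> 'a) set" where
  "isometry_group = {T. linear T \<and> surj T \<and> (\<forall>x. norm (T x) = norm x)}"

definition convex_transitive :: "'a::real_normed_vector itself \<Rightarrow> bool" where
  "convex_transitive _ \<longleftrightarrow>
     (\<forall>x::'a. norm x = 1 \<longrightarrow>
        closure (convex hull {T x | T. T \<in> isometry_group}) = cball 0 1)"

definition inner_product_on :: "'a::real_vector set \<Rightarrow> ('a \<Rightarrow> 'a \<Rightarrow> real) \<Rightarrow> bool" where
  "inner_product_on E ip \<longleftrightarrow>
     (\<forall>x\<in>E. \<forall>y\<in>E. ip x y = ip y x) \<and>
     (\<forall>x\<in>E. \<forall>y\<in>E. \<forall>z\<in>E. ip (x + y) z = ip x z + ip y z) \<and>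
     (\<forall>r. \<forall>x\<in>E. \<forall>y\<in>E. ip (r *\<^sub>R x) y = r * ip x y) \<and>
     (\<forall>x\<in>E. x \<noteq> 0 \<longrightarrow> ip x x > 0)"

definition fin_dim_subspace :: "'a::real_vector set \<Rightarrow> bool" where
  "fin_dim_subspace E \<longleftrightarrow> (\<exists>B. finite B \<and> span B = E)"

definition ellipsoid_in :: "'a::real_vector set \<Rightarrow> 'a set \<Rightarrow> bool" where
  "ellipsoid_in E S \<longleftrightarrow> (\<exists>ip. inner_product_on E ip \<and> S = {x\<in>E. ip x x \<le> 1})"

text \<open>Lebesgue measure on a finite-dimensional subspace \<open>E\<close> is only determined up to a positive
  factor. We normalise it by an arbitrarily chosen basis of \<open>E\<close>, taking the Lebesgue measure of the
  coordinates; another choice of basis rescales all volumes by the same constant, so it does not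
  affect which ellipsoid has minimum volume.\<close>

definition subspace_basis :: "'a::real_vector set \<Rightarrow> 'a set" where
  "subspace_basis E = (SOME B. independent B \<and> span B = E)"

definition subspace_volume :: "'a::real_vector set \<Rightarrow> 'a set \<Rightarrow> ennreal" where
  "subspace_volume E A =
     (let B = subspace_basis E; M = (\<Pi>\<^sub>M b\<in>B. (lborel :: real measure))
      in emeasure M {c \<in> space M. (\<Sum>b\<in>B. c b *\<^sub>R b) \<in> A})"

definition min_vol_ellipsoid :: "'a::real_normed_vector set \<Rightarrow> 'a set" where
  "min_vol_ellipsoid E =
     (THE S. is_arg_min (subspace_volume E) (\<lambda>S. ellipsoid_in E S \<and> cball 0 1 \<inter> E \<subseteq> S) S)"

text \<open>The supremum is a maximum, since ellipsoids in finite-dimensional subspaces are compact.\<close>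

definition eta :: "('a::real_normed_vector \<Rightarrow>\<^sub>L real) \<Rightarrow> 'a set \<Rightarrow> real" where
  "eta f E = (SUP y\<in>min_vol_ellipsoid E. \<bar>blinfun_apply f y\<bar>)"

definition DES_const :: "('a::real_normed_vector \<Rightarrow>\<^sub>L real) \<Rightarrow> ereal" where
  "DES_const f =
     (INF F\<in>{F. fin_dim_subspace F}.
        SUP E\<in>{E. fin_dim_subspace E \<and> F \<subseteq> E}. ereal (eta f E))"

definition has_DES :: "('a::real_normed_vector \<Rightarrow>\<^sub>L real) \<Rightarrow> bool" where
  "has_DES f \<longleftrightarrow> DES_const f < \<infinity>"

definition has_lambda_DES :: "real \<Rightarrow> ('a::real_normed_vector \<Rightarrow>\<^sub>L real) \<Rightarrow> bool" where
  "has_lambda_DES l f \<longleftrightarrow> 1 \<le> l \<and> DES_const f = ereal l"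

definition ip_norm :: "('a \<Rightarrow> 'a \<Rightarrow> real) \<Rightarrow> 'a \<Rightarrow> real" where
  "ip_norm ip x = sqrt (ip x x)"

definition ip_dist :: "('a::real_vector \<Rightarrow> 'a \<Rightarrow> real) \<Rightarrow> 'a \<Rightarrow> 'a \<Rightarrow> real" where
  "ip_dist ip x y = ip_norm ip (x - y)"

definition hilbert_inner_product :: "('a::real_vector \<Rightarrow> 'a \<Rightarrow> real) \<Rightarrow> bool" where
  "hilbert_inner_product ip \<longleftrightarrow>
     inner_product_on UNIV ip \<and> Metric_space.mcomplete UNIV (ip_dist ip)"

text \<open>HOL cannot quantify existentially over types, so the target Hilbert space is taken to be
  the vector space underlying \<open>'a\<close> with some complete inner product, in general unrelated to the
  given norm. This loses nothing: any Hilbert space in linear bijection with \<open>'a\<close> can be transported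
  to this form.\<close>

definition isomorphic_to_hilbert :: "'a::real_normed_vector itself \<Rightarrow> bool" where
  "isomorphic_to_hilbert _ \<longleftrightarrow>
     (\<exists>(ip :: 'a \<Rightarrow> 'a \<Rightarrow> real) (T :: 'a \<Rightarrow> 'a).
        hilbert_inner_product ip \<and> linear T \<and>
        homeomorphic_map euclidean (Metric_space.mtopology UNIV (ip_dist ip)) T)"

definition isometric_to_hilbert :: "'a::real_normed_vector itself \<Rightarrow> bool" where
  "isometric_to_hilbert _ \<longleftrightarrow>
     (\<exists>(ip :: 'a \<Rightarrow> 'a \<Rightarrow> real) (T :: 'a \<Rightarrow> 'a).
        hilbert_inner_product ip \<and> linear T \<and> bij T \<and> (\<forall>x. ip_norm ip (T x) = norm x))"

end

theory Submission
  imports Defs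
begin

text \<open>
  For a finite-dimensional subspace \<open>E\<close> let \<open>\<langle>_,_\<rangle>\<^sub>E\<close> be the inner product whose unit ball is the minimum
  volume ellipsoid of \<open>E\<close>. Since that ellipsoid contains the unit ball of \<open>E\<close>, we have
  \<open>\<langle>x,x\<rangle>\<^sub>E \<le> \<parallel>x\<parallel>\<^sup>2\<close>, and \<open>\<bar>f x\<bar> \<le> \<eta>(f,E) \<langle>x,x\<rangle>\<^sub>E\<^sup>1\<^sup>/\<^sup>2\<close> by definition of \<open>\<eta>\<close>. By Tychonoff's theorem these
  inner products have a cluster point \<open>p\<close> as \<open>E\<close> grows (lemma \<open>limit_inner_product\<close>), a positive
  semidefinite form with \<open>p x x \<le> \<parallel>x\<parallel>\<^sup>2\<close>. Let \<open>C\<close> exceed the DES constant of \<open>f\<close>. Minimum volume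
  ellipsoids are carried to each other by isometries (lemma \<open>min_vol_ellipsoid_isometry\<close>), so the DES
  constant of \<open>f \<circ> T\<close> is that of \<open>f\<close> for each isometry \<open>T\<close>, and in the limit
  \<open>\<bar>f (T x)\<bar> \<le> C (p x x)\<^sup>1\<^sup>/\<^sup>2\<close> for all \<open>T\<close> at once. If \<open>\<parallel>x\<parallel> = 1\<close>, then convex-transitivity makes the
  supremum of the left-hand side over \<open>T\<close> equal to \<open>\<parallel>f\<parallel> = 1\<close>, hence
  \<open>\<parallel>x\<parallel> \<le> C (p x x)\<^sup>1\<^sup>/\<^sup>2 \<le> C \<parallel>x\<parallel>\<close> for all \<open>x\<close> (lemma \<open>norm_le_limit_form\<close>). So \<open>p\<close> is an inner
  product whose norm is equivalent to the given one; if the DES constant is \<open>1\<close>, then every \<open>C > 1\<close> is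
  allowed and the two norms coincide.

  This uses that the minimum volume ellipsoid exists, is unique, and is equivariant. Equivariance needs
  that volumes on a subspace in different coordinates are proportional. This is uniqueness of Haar
  measure, proved by a double integral (lemma \<open>invariant_measure_proportional\<close>). Applied to dilations it
  also shows that the volume of \<open>{x. p x x \<le> 1}\<close> is a fixed multiple of the integral of
  \<open>h (p x x)\<close>, where \<open>h t = (max 0 (1 - t))\<^sup>2\<close> (lemma \<open>bump_integral_proportional\<close>). Convexity of \<open>h\<close>
  turns this into uniqueness of the minimiser (lemma \<open>minimal_form_unique\<close>), and Fatou's lemma into
  existence (lemma \<open>minimal_form_exists\<close>), without determinants or simultaneous diagonalisation.
\<close>

section \<open>Translation-invariant measures\<close>

text \<open>All volumes below live on the whole space, on the \<open>\<sigma>\<close>-algebra generated by the linear functionals,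
  so that the volumes of all subspaces have the same measurable sets and every linear map is
  measurable. A finite-dimensional subspace need not itself belong to this \<open>\<sigma>\<close>-algebra; instead of
  being concentrated on it, its volume is required to be invariant under a projection onto it.\<close>

definition functional_algebra :: "'a::real_vector measure" where
  "functional_algebra = sigma UNIV {{x. g x \<le> r} | g r. linear (g :: 'a \<Rightarrow> real)}"

lemma space_functional_algebra [simp]: "space functional_algebra = UNIV"
  by (simp add: functional_algebra_def)

lemma sets_functional_algebra:
  "sets (functional_algebra :: 'a::real_vector measure) =
     sigma_sets UNIV {{x. g x \<le> r} | g r. linear (g :: 'a \<Rightarrow> real)}"
  by (simp add: functional_algebra_def)

lemma measurable_functional [measurable (raw)]:
  fixes g :: "'a::real_vector \<Rightarrow> real"
  assumes "linear g" 
  shows "g \<in> borel_measurable functional_algebra"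
proof (rule borel_measurableI_le)
  fix y
  show "{x \<in> space functional_algebra. g x \<le> y} \<in> sets functional_algebra"
    using assms by (auto simp: sets_functional_algebra)
qed

lemma measurable_functional_algebraI:
  fixes f :: "'b \<Rightarrow> 'a::real_vector"
  assumes "\<And>g :: 'a \<Rightarrow> real. linear g \<Longrightarrow> (\<lambda>x. g (f x)) \<in> borel_measurable M"
  shows "f \<in> measurable M functional_algebra"
  unfolding functional_algebra_def
proof (rule measurable_measure_of)
  show "f -` A \<inter> space M \<in> sets M"
    if "A \<in> {{x. g x \<le> r} | g r. linear (g :: 'a \<Rightarrow> real)}" for A
  proof -
    from that obtain g :: "'a \<Rightarrow> real" and r where A: "A = {x. g x \<le> r}" and g: "linear g" by blast
    have "{x \<in> space M. g (f x) \<le> r} \<in> sets M"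
      using assms[OF g] by measurable
    moreover have "f -` A \<inter> space M = {x \<in> space M. g (f x) \<le> r}" by (auto simp: A)
    ultimately show ?thesis by simp
  qed
qed auto

lemma measurable_linear:
  fixes T :: "'a::real_vector \<Rightarrow> 'b::real_vector"
  assumes "linear T"
  shows "T \<in> measurable functional_algebra functional_algebra"
  by (intro measurable_functional_algebraI measurable_functional)
     (use linear_compose[OF assms] in \<open>auto simp: o_def\<close>)

lemma measurable_add_functional_algebra:
  "(\<lambda>(x, y). x + y) \<in> measurable
     (functional_algebra \<Otimes>\<^sub>M functional_algebra) (functional_algebra :: 'a::real_vector measure)"
proof (rule measurable_functional_algebraI)
  fix g :: "'a \<Rightarrow> real" assume g: "linear g"
  have [measurable]: "g \<in> borel_measurable functional_algebra" using g by (rule measurable_functional)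
  show "(\<lambda>z. g (case z of (x, y) \<Rightarrow> x + y)) \<in> borel_measurable (functional_algebra \<Otimes>\<^sub>M functional_algebra)"
    by (simp add: split_beta linear_add[OF g])
qed

lemma measurable_plus_functional_algebra [measurable (raw)]:
  assumes "f \<in> measurable M (functional_algebra :: 'a::real_vector measure)"
    and "h \<in> measurable M functional_algebra"
  shows "(\<lambda>x. f x + h x) \<in> measurable M functional_algebra"
  using measurable_compose[OF measurable_Pair[OF assms] measurable_add_functional_algebra] by simp

lemma measurable_diff_functional_algebra [measurable (raw)]:
  assumes f: "f \<in> measurable M (functional_algebra :: 'a::real_vector measure)"
    and h: "h \<in> measurable M functional_algebra"
  shows "(\<lambda>x. f x - h x) \<in> measurable M functional_algebra"
proof -
  have "linear (uminus :: 'a \<Rightarrow> 'a)" by (auto intro: linearI)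
  from measurable_plus_functional_algebra[OF f measurable_compose[OF h measurable_linear[OF this]]]
  show ?thesis by simp
qed

text \<open>Uniqueness of Haar measure: integrate \<open>1\<^sub>A(x) 1\<^sub>B(x + y)\<close> in both orders. Integrating over \<open>y\<close>
  first gives \<open>\<mu>(A) \<nu>(B)\<close>; integrating over \<open>x\<close> first and substituting \<open>x - y\<close> for \<open>x\<close> gives
  \<open>\<mu>(B) \<nu>(-A)\<close>. Both measures are carried by the range of \<open>P\<close>, and only translations by vectors of
  that range preserve them, so every vector is sent through \<open>P\<close> first.\<close>

lemma invariant_measure_proportional:
  fixes \<mu> \<nu> :: "'a::real_vector measure" and P :: "'a \<Rightarrow> 'a"
  assumes "sigma_finite_measure \<mu>" "sigma_finite_measure \<nu>"
    and sets_eq: "sets \<mu> = sets functional_algebra" "sets \<nu> = sets functional_algebra"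
    and P: "linear P" "\<And>x. P (P x) = P x"
    and conc: "distr \<mu> functional_algebra P = \<mu>" "distr \<nu> functional_algebra P = \<nu>"
    and inv: "\<And>a. distr \<mu> functional_algebra (\<lambda>x. x + P a) = \<mu>"
             "\<And>a. distr \<nu> functional_algebra (\<lambda>x. x + P a) = \<nu>"
    and A: "A \<in> sets functional_algebra" and B: "B \<in> sets functional_algebra"
    and sym: "\<And>x. - x \<in> A \<longleftrightarrow> x \<in> A"
  shows "emeasure \<mu> A * emeasure \<nu> B = emeasure \<mu> B * emeasure \<nu> A"
proof -
  interpret \<mu>: sigma_finite_measure \<mu> by fact
  interpret \<nu>: sigma_finite_measure \<nu> by fact
  interpret pair_sigma_finite \<mu> \<nu> ..
  note [measurable_cong] = sets_eq
  note [measurable] = A B measurable_linear[OF P(1)]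
  have Pa: "P (x + y) = P x + P y" "P (x - y) = P x - P y" for x y
    using P(1) by (auto simp: linear_add linear_diff)
  have sp: "space \<mu> = UNIV" "space \<nu> = UNIV"
    using sets_eq by (auto dest!: sets_eq_imp_space_eq)
  have shift: "(\<integral>\<^sup>+x. F (x + P a) \<partial>\<mu>) = (\<integral>\<^sup>+x. F x \<partial>\<mu>)" "(\<integral>\<^sup>+x. F (x + P a) \<partial>\<nu>) = (\<integral>\<^sup>+x. F x \<partial>\<nu>)"
    if [measurable]: "F \<in> borel_measurable functional_algebra" for F a
    by (subst (2) inv[of a, symmetric], simp add: nn_integral_distr)+
  have proj: "(\<integral>\<^sup>+x. indicator S (P x) \<partial>\<mu>) = emeasure \<mu> S" "(\<integral>\<^sup>+x. indicator S (P x) \<partial>\<nu>) = emeasure \<nu> S"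
    if [measurable]: "S \<in> sets functional_algebra" for S
    using nn_integral_distr[of P \<mu> functional_algebra "indicator S"]
      nn_integral_distr[of P \<nu> functional_algebra "indicator S"]
    by (simp_all add: conc sets_eq)
  have "emeasure \<mu> A * emeasure \<nu> B = (\<integral>\<^sup>+x. indicator A (P x) * (\<integral>\<^sup>+y. indicator B (P (x + y)) \<partial>\<nu>) \<partial>\<mu>)"
  proof -
    have "(\<integral>\<^sup>+y. indicator B (P (x + y)) \<partial>\<nu>) = emeasure \<nu> B" for x
    proof -
      have "(\<integral>\<^sup>+y. indicator B (P (x + y)) \<partial>\<nu>) = (\<integral>\<^sup>+y. indicator B (P (y + P x)) \<partial>\<nu>)"
        by (simp add: Pa P(2) add.commute)
      also have "\<dots> = emeasure \<nu> B"
        by (subst shift(2)) (auto simp: proj)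
      finally show ?thesis .
    qed
    then show ?thesis by (simp add: nn_integral_multc proj)
  qed
  also have "\<dots> = (\<integral>\<^sup>+x. (\<integral>\<^sup>+y. indicator A (P x) * indicator B (P (x + y)) \<partial>\<nu>) \<partial>\<mu>)"
    by (simp add: nn_integral_cmult)
  also have "\<dots> = (\<integral>\<^sup>+y. (\<integral>\<^sup>+x. indicator A (P x) * indicator B (P (x + y)) \<partial>\<mu>) \<partial>\<nu>)"
    by (rule Fubini'[symmetric]) simp
  \<comment> \<open>The substitution \<open>x \<mapsto> x - P y\<close> in the inner integral.\<close>
  also have "\<dots> = (\<integral>\<^sup>+y. (\<integral>\<^sup>+x. indicator A (P x - P y) * indicator B (P x) \<partial>\<mu>) \<partial>\<nu>)"
  proof (rule nn_integral_cong)
    fix y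
    show "(\<integral>\<^sup>+x. indicator A (P x) * indicator B (P (x + y)) \<partial>\<mu>)
        = (\<integral>\<^sup>+x. indicator A (P x - P y) * indicator B (P x) \<partial>\<mu> :: ennreal)"
      by (subst shift(1)[of _ y, symmetric]) (auto simp: Pa P(2))
  qed
  also have "\<dots> = (\<integral>\<^sup>+x. (\<integral>\<^sup>+y. indicator A (P x - P y) * indicator B (P x) \<partial>\<nu>) \<partial>\<mu>)"
    by (rule Fubini') simp
  also have "\<dots> = (\<integral>\<^sup>+x. indicator B (P x) * (\<integral>\<^sup>+y. indicator A (P x - P y) \<partial>\<nu>) \<partial>\<mu>)"
    by (simp add: nn_integral_cmult nn_integral_multc mult.commute)
  also have "\<dots> = emeasure \<mu> B * emeasure \<nu> A"
  proof -
    have "(\<integral>\<^sup>+y. indicator A (P x - P y) \<partial>\<nu>) = emeasure \<nu> A" for x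
    proof -
      have "indicator A (P x - P y) = (indicator A (P (y + P (- x))) :: ennreal)" for y
        using sym[of "P x - P y"] by (simp add: Pa P(2) linear_neg[OF P(1)] indicator_def)
      then have "(\<integral>\<^sup>+y. indicator A (P x - P y) \<partial>\<nu>) = (\<integral>\<^sup>+y. indicator A (P (y + P (- x))) \<partial>\<nu>)"
        by simp
      also have "\<dots> = emeasure \<nu> A"
        by (subst shift(2)) (auto simp: proj)
      finally show ?thesis .
    qed
    then show ?thesis by (simp add: nn_integral_multc proj)
  qed
  finally show ?thesis .
qed

lemma PiM_lborel_translation:
  fixes d :: "'i \<Rightarrow> real"
  assumes "finite I"
  shows "distr (PiM I (\<lambda>_. lborel)) (PiM I (\<lambda>_. lborel)) (\<lambda>c. \<lambda>i\<in>I. c i + d i) = PiM I (\<lambda>_. lborel)"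
proof -
  interpret product_sigma_finite "\<lambda>_::'i. lborel :: real measure" by standard
  show ?thesis
  proof (rule PiM_eqI)
    fix A :: "'i \<Rightarrow> real set" assume A: "\<And>i. i \<in> I \<Longrightarrow> A i \<in> sets lborel"
    have "emeasure (distr (PiM I (\<lambda>_. lborel)) (PiM I (\<lambda>_. lborel)) (\<lambda>c. \<lambda>i\<in>I. c i + d i)) (Pi\<^sub>E I A)
       = emeasure (PiM I (\<lambda>_. lborel)) (Pi\<^sub>E I (\<lambda>i. {x. x + d i \<in> A i}))"
      using A assms
      by (subst emeasure_distr) (auto intro!: arg_cong2[where f=emeasure] simp: space_PiM PiE_iff extensional_def sets_PiM_I_finite)
    also have "\<dots> = (\<Prod>i\<in>I. emeasure lborel {x. x + d i \<in> A i})"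
    proof (rule emeasure_PiM[OF assms])
      fix i assume "i \<in> I"
      have "(\<lambda>x. x + d i) -` A i \<inter> space lborel \<in> sets lborel"
        using A[OF \<open>i \<in> I\<close>] by (intro measurable_sets[of _ _ lborel]) auto
      then show "{x. x + d i \<in> A i} \<in> sets lborel" by (simp add: vimage_def)
    qed
    also have "\<dots> = (\<Prod>i\<in>I. emeasure lborel (A i))"
    proof (rule prod.cong[OF refl])
      fix i assume "i \<in> I"
      have "emeasure lborel (A i) = emeasure (distr lborel borel ((+) (d i))) (A i)"
        by (simp add: lborel_distr_plus)
      also have "\<dots> = emeasure lborel {x. x + d i \<in> A i}"
        using A[OF \<open>i \<in> I\<close>] by (subst emeasure_distr) (auto simp: vimage_def add.commute)
      finally show "emeasure lborel {x. x + d i \<in> A i} = emeasure lborel (A i)" by simp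
    qed
    finally show "emeasure (distr (PiM I (\<lambda>_. lborel)) (PiM I (\<lambda>_. lborel)) (\<lambda>c. \<lambda>i\<in>I. c i + d i)) (Pi\<^sub>E I A)
       = (\<Prod>i\<in>I. emeasure lborel (A i))" .
  qed (use assms in auto)
qed

section \<open>Volume in a coordinate frame\<close>

text \<open>The vectors \<open>e i\<close> form a basis of a subspace. The dual functionals are given on the whole space:
  this makes the projection onto the subspace linear, hence measurable, on the whole space. Keeping a
  basis as an indexed family lets a linear map transport it without re-indexing the product measure.\<close>

locale coordinate_frame =
  fixes I :: "'i set" and e :: "'i \<Rightarrow> 'a::real_vector" and g :: "'i \<Rightarrow> 'a \<Rightarrow> real"
  assumes finite_index: "finite I"
    and linear_coord: "\<And>i. linear (g i)"
    and coord_e: "\<And>i j. i \<in> I \<Longrightarrow> j \<in> I \<Longrightarrow> g i (e j) = (if i = j then 1 else 0)"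
begin

definition lincomb :: "('i \<Rightarrow> real) \<Rightarrow> 'a" where
  "lincomb c = (\<Sum>i\<in>I. c i *\<^sub>R e i)"

definition vol :: "'a measure" where
  "vol = distr (PiM I (\<lambda>_. lborel)) functional_algebra lincomb"

definition proj :: "'a \<Rightarrow> 'a" where
  "proj x = lincomb (\<lambda>i. g i x)"

lemma linear_proj: "linear proj"
  by (rule linearI)
     (simp_all add: proj_def lincomb_def linear_add[OF linear_coord] linear_cmul[OF linear_coord]
       scaleR_add_left sum.distrib scaleR_sum_right)

lemma coord_lincomb: "i \<in> I \<Longrightarrow> g i (lincomb c) = c i"
proof -
  assume i: "i \<in> I"
  have "g i (lincomb c) = (\<Sum>j\<in>I. c j * g i (e j))"
    by (simp add: lincomb_def linear_sum[OF linear_coord] linear_cmul[OF linear_coord])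
  also have "\<dots> = (\<Sum>j\<in>I. if i = j then c j else 0)"
    by (rule sum.cong) (auto simp: coord_e i)
  also have "\<dots> = c i" using i finite_index by simp
  finally show ?thesis .
qed

lemma lincomb_cong: "(\<And>i. i \<in> I \<Longrightarrow> c i = d i) \<Longrightarrow> lincomb c = lincomb d"
  unfolding lincomb_def by (rule sum.cong) auto

lemma proj_lincomb [simp]: "proj (lincomb c) = lincomb c"
  unfolding proj_def by (rule lincomb_cong) (simp add: coord_lincomb)

lemma proj_proj [simp]: "proj (proj x) = proj x"
  by (subst (1 2) proj_def) simp

lemma coord_proj: "i \<in> I \<Longrightarrow> g i (proj x) = g i x"
  by (simp add: proj_def coord_lincomb)

lemma lincomb_in_span [simp]: "lincomb c \<in> span (e ` I)"
  unfolding lincomb_def by (intro span_sum span_scale span_base) auto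

lemma proj_in_span [simp]: "proj x \<in> span (e ` I)"
  by (simp add: proj_def)

lemma proj_span [simp]: "x \<in> span (e ` I) \<Longrightarrow> proj x = x"
proof (induction rule: span_induct_alt)
  case base
  show ?case using linear_0[OF linear_proj] .
next
  case (step c x y)
  then obtain j where j: "j \<in> I" "x = e j" by blast
  have "x = lincomb (\<lambda>i. if i = j then 1 else 0)"
    unfolding lincomb_def using j finite_index
    by (simp add: if_distrib[where f = "\<lambda>a. a *\<^sub>R _"] cong: if_cong)
  then have "proj x = x" by (metis proj_lincomb)
  then show ?case using step
    by (simp add: linear_add[OF linear_proj] linear_cmul[OF linear_proj])
qed

lemma e_in_span: "i \<in> I \<Longrightarrow> e i \<in> span (e ` I)"
  by (simp add: span_base)

lemma measurable_lincomb [measurable]: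
  "lincomb \<in> measurable (PiM I (\<lambda>_. lborel)) functional_algebra"
proof (rule measurable_functional_algebraI)
  fix h :: "'a \<Rightarrow> real" assume h: "linear h"
  have "(\<lambda>c. h (lincomb c)) = (\<lambda>c. \<Sum>i\<in>I. c i * h (e i))"
    by (simp add: lincomb_def linear_sum[OF h] linear_cmul[OF h])
  then show "(\<lambda>c. h (lincomb c)) \<in> borel_measurable (PiM I (\<lambda>_. lborel))"
    by simp
qed

lemma measurable_proj [measurable]: "proj \<in> measurable functional_algebra functional_algebra"
  by (rule measurable_linear[OF linear_proj])

lemma measurable_coord [measurable]: "g i \<in> borel_measurable functional_algebra"
  by (rule measurable_functional[OF linear_coord])

lemma sets_vol [simp, measurable_cong]: "sets vol = sets functional_algebra"
  by (simp add: vol_def)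

lemma space_vol [simp]: "space vol = UNIV"
  by (simp add: vol_def)

lemma emeasure_vol:
  assumes "A \<in> sets functional_algebra"
  shows "emeasure vol A = emeasure (PiM I (\<lambda>_. lborel)) {c \<in> space (PiM I (\<lambda>_. lborel)). lincomb c \<in> A}"
  unfolding vol_def using assms
  by (subst emeasure_distr) (auto intro!: arg_cong2[where f=emeasure])

lemma distr_vol_fixed:
  assumes P: "linear P" and "\<And>x. x \<in> span (e ` I) \<Longrightarrow> P x = x"
  shows "distr vol functional_algebra P = vol"
  unfolding vol_def
  by (subst distr_distr[OF measurable_linear[OF P] measurable_lincomb])
     (simp add: o_def assms(2))

lemma vol_translation:
  assumes a: "a \<in> span (e ` I)"
  shows "distr vol functional_algebra (\<lambda>x. x + a) = vol"
proof -
  let ?M = "PiM I (\<lambda>_. lborel) :: ('i \<Rightarrow> real) measure"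
  let ?d = "\<lambda>i. g i a"
  have a_eq: "a = lincomb ?d" using proj_span[OF a] by (simp add: proj_def)
  have "distr vol functional_algebra (\<lambda>x. x + a) = distr ?M functional_algebra (\<lambda>c. lincomb c + a)"
    unfolding vol_def by (subst distr_distr) (auto simp: o_def)
  also have "(\<lambda>c. lincomb c + a) = (\<lambda>c. lincomb (\<lambda>i\<in>I. c i + ?d i))"
    by (subst a_eq) (auto simp: lincomb_def sum.distrib[symmetric] scaleR_add_left intro!: sum.cong)
  also have "distr ?M functional_algebra (\<lambda>c. lincomb (\<lambda>i\<in>I. c i + ?d i))
     = distr (distr ?M ?M (\<lambda>c. \<lambda>i\<in>I. c i + ?d i)) functional_algebra lincomb"
    by (subst distr_distr) (auto simp: o_def)
  also have "\<dots> = vol"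
    by (simp add: PiM_lborel_translation[OF finite_index] vol_def)
  finally show ?thesis .
qed

lemma box_measurable [measurable]: "{x. \<forall>i\<in>I. \<bar>g i x\<bar> \<le> r} \<in> sets functional_algebra"
proof -
  have "{x \<in> space functional_algebra. \<forall>i\<in>I. \<bar>g i x\<bar> \<le> r} \<in> sets functional_algebra"
    using finite_index by measurable
  then show ?thesis by simp
qed

lemma emeasure_box_finite: "emeasure vol {x. \<forall>i\<in>I. \<bar>g i x\<bar> \<le> r} < \<infinity>"
proof -
  interpret product_sigma_finite "\<lambda>_::'i. lborel :: real measure" by standard
  have "emeasure vol {x. \<forall>i\<in>I. \<bar>g i x\<bar> \<le> r} = emeasure (PiM I (\<lambda>_. lborel)) (Pi\<^sub>E I (\<lambda>_. {-r..r}))"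
  proof -
    have "{c \<in> space (PiM I (\<lambda>_. lborel)). lincomb c \<in> {x. \<forall>i\<in>I. \<bar>g i x\<bar> \<le> r}} = Pi\<^sub>E I (\<lambda>_. {-r..r})"
      by (auto simp: space_PiM PiE_iff coord_lincomb abs_le_iff minus_le_iff extensional_def)
    then show ?thesis by (subst emeasure_vol) auto
  qed
  also have "\<dots> = (\<Prod>i\<in>I. emeasure lborel {-r..r})"
    by (rule emeasure_PiM[OF finite_index]) auto
  also have "\<dots> < \<infinity>"
    by (auto simp: emeasure_lborel_Icc_eq power_less_top_ennreal)
  finally show ?thesis .
qed

lemma sigma_finite_vol: "sigma_finite_measure vol"
proof
  show "\<exists>A. countable A \<and> A \<subseteq> sets vol \<and> \<Union>A = space vol \<and> (\<forall>a\<in>A. emeasure vol a \<noteq> \<infinity>)"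
  proof (intro exI conjI)
    let ?A = "range (\<lambda>n::nat. {x. \<forall>i\<in>I. \<bar>g i x\<bar> \<le> real n})"
    show "countable ?A" by simp
    show "?A \<subseteq> sets vol" by auto
    show "\<forall>a\<in>?A. emeasure vol a \<noteq> \<infinity>" using emeasure_box_finite by (auto simp: less_top)
    have "\<exists>n::nat. \<forall>i\<in>I. \<bar>g i x\<bar> \<le> real n" for x
    proof -
      obtain n :: nat where "(\<Sum>i\<in>I. \<bar>g i x\<bar>) \<le> real n" using real_arch_simple by blast
      then have "\<forall>i\<in>I. \<bar>g i x\<bar> \<le> real n"
        using finite_index by (meson abs_ge_zero member_le_sum order_trans)
      then show ?thesis ..
    qed
    then show "\<Union>?A = space vol" by auto
  qed
qed

text \<open>An open set of coordinate vectors contains a product of open sets around each of its points. Product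
  measures see functions that are \<open>undefined\<close> off the index set, so the chosen point is normalised
  in this way.\<close>

lemma emeasure_open_pos:
  assumes A: "A \<in> sets functional_algebra"
    and op: "open {c. lincomb c \<in> A}" and x: "x \<in> A" "x \<in> span (e ` I)"
  shows "emeasure vol A > 0"
proof -
  interpret product_sigma_finite "\<lambda>_::'i. lborel :: real measure" by standard
  define c0 where "c0 = (\<lambda>i\<in>I. g i x)"
  have "lincomb c0 = proj x" unfolding proj_def by (rule lincomb_cong) (simp add: c0_def)
  then have "c0 \<in> {c. lincomb c \<in> A}" using x by simp
  from product_topology_open_contains_basis[OF op[unfolded open_fun_def] this]
  obtain X where X: "c0 \<in> Pi\<^sub>E UNIV X" "\<And>i. open (X i)" "Pi\<^sub>E UNIV X \<subseteq> {c. lincomb c \<in> A}"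
    by (auto simp: Pi_def)
  have "0 < (\<Prod>i\<in>I. emeasure lborel (X i))"
  proof -
    have "emeasure lborel (X i) \<noteq> 0" if "i \<in> I" for i
    proof -
      have "c0 i \<in> X i" using X(1) by auto
      then obtain r where r: "r > 0" "ball (c0 i) r \<subseteq> X i"
        using X(2)[of i] by (auto simp: open_contains_ball)
      have "0 < emeasure lborel {c0 i - r / 2 .. c0 i + r / 2}" using r by (simp add: emeasure_lborel_Icc_eq)
      also have "\<dots> \<le> emeasure lborel (X i)"
      proof (rule emeasure_mono)
        show "{c0 i - r / 2 .. c0 i + r / 2} \<subseteq> X i"
          using r by (intro order_trans[OF _ r(2)]) (auto simp: dist_real_def abs_less_iff field_simps)
      qed (use X(2)[of i] in auto)
      finally show ?thesis by simp
    qed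
    then show ?thesis using finite_index by (simp add: zero_less_iff_neq_zero)
  qed
  also have "\<dots> = emeasure (PiM I (\<lambda>_. lborel)) (Pi\<^sub>E I X)"
    using X(2) by (subst emeasure_PiM[OF finite_index]) auto
  also have "\<dots> \<le> emeasure vol A"
  proof (subst emeasure_vol[OF A], rule emeasure_mono)
    have "c \<in> Pi\<^sub>E UNIV X" if "c \<in> Pi\<^sub>E I X" for c
    proof (rule PiE_I)
      fix i
      show "c i \<in> X i"
      proof (cases "i \<in> I")
        case False
        then have "c i = c0 i" using that by (auto simp: c0_def PiE_iff extensional_def)
        then show ?thesis using X(1) by auto
      qed (use that in auto)
    qed auto
    then have "Pi\<^sub>E I X \<subseteq> Pi\<^sub>E UNIV X" by blast
    moreover have "Pi\<^sub>E I X \<subseteq> space (PiM I (\<lambda>_. lborel))" by (auto simp: space_PiM)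
    ultimately show "Pi\<^sub>E I X \<subseteq> {c \<in> space (PiM I (\<lambda>_. lborel)). lincomb c \<in> A}"
      using X(3) by blast
    have "{c \<in> space (PiM I (\<lambda>_. lborel)). lincomb c \<in> A} = lincomb -` A \<inter> space (PiM I (\<lambda>_. lborel))"
      by auto
    also have "\<dots> \<in> sets (PiM I (\<lambda>_. lborel))"
      by (rule measurable_sets[OF measurable_lincomb A])
    finally show "{c \<in> space (PiM I (\<lambda>_. lborel)). lincomb c \<in> A} \<in> sets (PiM I (\<lambda>_. lborel))" .
  qed
  finally show ?thesis .
qed

end

section \<open>Quadratic forms on a frame\<close>

definition psd_form :: "('a::real_vector \<Rightarrow> 'a \<Rightarrow> real) \<Rightarrow> bool" where
  "psd_form p \<longleftrightarrow>
     (\<forall>x y. p x y = p y x) \<and> (\<forall>x y z. p (x + y) z = p x z + p y z) \<and>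
     (\<forall>r x y. p (r *\<^sub>R x) y = r * p x y) \<and> (\<forall>x. 0 \<le> p x x)"

lemma
  assumes "psd_form p"
  shows psd_form_sym: "p x y = p y x"
    and psd_form_add: "p (x + y) z = p x z + p y z" "p z (x + y) = p z x + p z y"
    and psd_form_scale: "p (r *\<^sub>R x) y = r * p x y" "p y (r *\<^sub>R x) = r * p y x"
    and psd_form_nonneg: "0 \<le> p x x"
    and psd_form_0: "p 0 y = 0" "p y 0 = 0"
    and psd_form_linear: "linear (\<lambda>x. p x y)" "linear (p y)"
proof -
  have 1: "p x y = p y x" for x y using assms unfolding psd_form_def by blast
  have 2: "p (x + y) z = p x z + p y z" for x y z using assms unfolding psd_form_def by blast
  have 3: "p (r *\<^sub>R x) y = r * p x y" for r x y using assms unfolding psd_form_def by blast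
  show "p x y = p y x" "p (x + y) z = p x z + p y z" "p (r *\<^sub>R x) y = r * p x y" by (fact 1 2 3)+
  show 4: "p z (x + y) = p z x + p z y" for x y z 
    unfolding 1[of z "x + y"] 2 by (simp only: 1[of x z] 1[of y z])
  show 5: "p y (r *\<^sub>R x) = r * p y x" for x y r 
    unfolding 1[of y "r *\<^sub>R x"] 3 by (simp only: 1[of x y])
  show "0 \<le> p x x" using assms by (simp add: psd_form_def)
  show "p 0 y = 0" "p y 0 = 0" using 3[of 0 0 y] 5[of y 0 0] by auto
  show "linear (\<lambda>x. p x y)" "linear (p y)" by (auto intro!: linearI simp: 2 3 4 5)
qed

text \<open>The value \<open>p (x + t w, x + t w)\<close> is affine in \<open>t\<close> and never negative, so its slope vanishes.\<close>

lemma psd_form_null_vector: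
  assumes p: "psd_form p" and w: "p w w = 0"
  shows "p x w = 0"
proof (rule ccontr)
  assume nz: "p x w \<noteq> 0"
  define t where "t = - (p x x + 1) / (2 * p x w)"
  have "0 \<le> p (x + t *\<^sub>R w) (x + t *\<^sub>R w)" by (rule psd_form_nonneg[OF p])
  also have "\<dots> = p x x + 2 * t * p x w"
    using psd_form_sym[OF p, of w x] by (simp add: psd_form_add[OF p] psd_form_scale[OF p] w)
  also have "\<dots> = -1" using nz by (simp add: t_def field_simps)
  finally show False by simp
qed

lemma psd_form_polarization:
  assumes p: "psd_form p"
  shows "p x y = (p (x + y) (x + y) - p x x - p y y) / 2"
  using psd_form_sym[OF p, of y x] by (simp add: psd_form_add[OF p])

context coordinate_frame
begin

lemma lincomb_cmul: "lincomb (\<lambda>i. r * c i) = r *\<^sub>R lincomb c"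
  by (simp add: lincomb_def scaleR_sum_right)

lemma continuous_functional_lincomb:
  fixes h :: "'a \<Rightarrow> real"
  assumes "linear h"
  shows "continuous_on UNIV (\<lambda>c. h (lincomb c))"
  unfolding lincomb_def linear_sum[OF assms] linear_cmul[OF assms]
  by (intro continuous_intros continuous_on_product_coordinates)

text \<open>The second condition says that the form only sees the component in the subspace. It makes the form a
  quadratic polynomial in finitely many linear functionals, so that its sublevel sets are
  measurable.\<close>

definition frame_form :: "('a \<Rightarrow> 'a \<Rightarrow> real) \<Rightarrow> bool" where
  "frame_form p \<longleftrightarrow> psd_form p \<and> (\<forall>x y. p (proj x) (proj y) = p x y)"

lemma frame_form_psd: "frame_form p \<Longrightarrow> psd_form p"
  by (simp add: frame_form_def)

lemma form_lincomb:
  assumes "psd_form p"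
  shows "p (lincomb c) (lincomb d) = (\<Sum>i\<in>I. \<Sum>j\<in>I. c i * d j * p (e i) (e j))"
proof -
  have "p (lincomb c) (lincomb d) = (\<Sum>i\<in>I. c i * p (e i) (lincomb d))"
    by (simp add: lincomb_def[of c] linear_sum[OF psd_form_linear(1)[OF assms]] psd_form_scale[OF assms])
  moreover have "p (e i) (lincomb d) = (\<Sum>j\<in>I. d j * p (e i) (e j))" for i
    by (simp add: lincomb_def linear_sum[OF psd_form_linear(2)[OF assms]] psd_form_scale[OF assms])
  ultimately show ?thesis by (simp add: sum_distrib_left mult.assoc)
qed

lemma frame_form_coords:
  assumes "frame_form p"
  shows "p x y = (\<Sum>i\<in>I. \<Sum>j\<in>I. g i x * g j y * p (e i) (e j))"
proof -
  have "p x y = p (proj x) (proj y)" using assms by (simp add: frame_form_def)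
  then show ?thesis by (simp add: proj_def form_lincomb[OF frame_form_psd[OF assms]])
qed

lemma measurable_frame_form:
  assumes "frame_form p"
  shows "(\<lambda>x. p x x) \<in> borel_measurable functional_algebra"
proof -
  have "(\<lambda>x. p x x) = (\<lambda>x. \<Sum>i\<in>I. \<Sum>j\<in>I. g i x * g j x * p (e i) (e j))"
    by (rule ext) (rule frame_form_coords[OF assms])
  then show ?thesis by simp
qed

lemma sublevel_measurable:
  assumes "frame_form q"
  shows "{x. q x x \<le> r} \<in> sets functional_algebra"
proof -
  note [measurable] = measurable_frame_form[OF assms]
  have "{x \<in> space functional_algebra. q x x \<le> r} \<in> sets functional_algebra" by measurable
  then show ?thesis by simp
qed

lemma continuous_form_lincomb:
  assumes "psd_form p"
  shows "continuous_on UNIV (\<lambda>c. p (lincomb c) (lincomb c))"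
  unfolding form_lincomb[OF assms]
  by (intro continuous_intros continuous_on_product_coordinates)

lemma frame_form_matrix:
  assumes sym: "\<And>i j. i \<in> I \<Longrightarrow> j \<in> I \<Longrightarrow> a i j = a j i"
    and nonneg: "\<And>c. 0 \<le> (\<Sum>i\<in>I. \<Sum>j\<in>I. c i * c j * a i j)"
  shows "frame_form (\<lambda>x y. \<Sum>i\<in>I. \<Sum>j\<in>I. g i x * g j y * a i j)"
  unfolding frame_form_def psd_form_def
proof (intro conjI allI)
  fix x y
  have "(\<Sum>i\<in>I. \<Sum>j\<in>I. g i x * g j y * a i j) = (\<Sum>j\<in>I. \<Sum>i\<in>I. g i x * g j y * a i j)"
    by (rule sum.swap)
  also have "\<dots> = (\<Sum>j\<in>I. \<Sum>i\<in>I. g j y * g i x * a j i)"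
    by (intro sum.cong refl) (auto simp: sym)
  finally show "(\<Sum>i\<in>I. \<Sum>j\<in>I. g i x * g j y * a i j) = (\<Sum>i\<in>I. \<Sum>j\<in>I. g i y * g j x * a i j)" .
next
  show "(\<Sum>i\<in>I. \<Sum>j\<in>I. g i (x + y) * g j z * a i j)
      = (\<Sum>i\<in>I. \<Sum>j\<in>I. g i x * g j z * a i j) + (\<Sum>i\<in>I. \<Sum>j\<in>I. g i y * g j z * a i j)" for x y z
    by (simp add: linear_add[OF linear_coord] distrib_right sum.distrib)
  show "(\<Sum>i\<in>I. \<Sum>j\<in>I. g i (r *\<^sub>R x) * g j y * a i j)
      = r * (\<Sum>i\<in>I. \<Sum>j\<in>I. g i x * g j y * a i j)" for r x y
    by (simp add: linear_cmul[OF linear_coord] sum_distrib_left mult.assoc)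
  show "0 \<le> (\<Sum>i\<in>I. \<Sum>j\<in>I. g i x * g j x * a i j)" for x by (rule nonneg)
  show "(\<Sum>i\<in>I. \<Sum>j\<in>I. g i (proj x) * g j (proj y) * a i j) = (\<Sum>i\<in>I. \<Sum>j\<in>I. g i x * g j y * a i j)" for x y
    by (simp add: coord_proj)
qed

lemma inner_product_frame_form:
  assumes ip: "inner_product_on (span (e ` I)) ip"
  shows "frame_form (\<lambda>x y. ip (proj x) (proj y))"
proof -
  have "ip 0 0 = 0 * ip 0 0" using ip span_zero[of "e ` I"] unfolding inner_product_on_def
    by (metis scale_zero_left)
  then have "0 \<le> ip x x" if "x \<in> span (e ` I)" for x
    using ip that unfolding inner_product_on_def by (cases "x = 0") (auto simp: less_imp_le)
  then show ?thesis
    using ip unfolding frame_form_def psd_form_def inner_product_on_def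
    by (auto simp: linear_add[OF linear_proj] linear_cmul[OF linear_proj])
qed

lemma inner_product_ellipsoid:
  assumes "inner_product_on (span (e ` I)) ip"
  obtains q where "frame_form q" "\<And>x y. x \<in> span (e ` I) \<Longrightarrow> y \<in> span (e ` I) \<Longrightarrow> q x y = ip x y"
    "{x \<in> span (e ` I). ip x x \<le> 1} = {x. q x x \<le> 1} \<inter> span (e ` I)"
  by (rule that[OF inner_product_frame_form[OF assms]]) auto

lemma emeasure_pos_at_0:
  assumes A: "A \<in> sets functional_algebra" and U: "open {c. lincomb c \<in> U}" and "U \<subseteq> A" "0 \<in> U"
    and UA: "U \<in> sets functional_algebra"
  shows "emeasure vol A > 0"
proof -
  have "0 < emeasure vol U"
    by (rule emeasure_open_pos[OF UA U \<open>0 \<in> U\<close>]) (rule span_zero)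
  also have "\<dots> \<le> emeasure vol A"
    using A \<open>U \<subseteq> A\<close> by (intro emeasure_mono) auto
  finally show ?thesis .
qed

lemma frame_form_sublevel_pos:
  assumes p: "frame_form p" and r: "r > 0"
  shows "emeasure vol {x. p x x \<le> r} > 0"
proof (rule emeasure_pos_at_0[where U = "{x. p x x < r}"])
  note [measurable] = measurable_frame_form[OF p]
  have "{x \<in> space functional_algebra. p x x \<le> r} \<in> sets functional_algebra"
    "{x \<in> space functional_algebra. p x x < r} \<in> sets functional_algebra" by measurable
  then show "{x. p x x \<le> r} \<in> sets functional_algebra" "{x. p x x < r} \<in> sets functional_algebra"
    by simp_all
  show "open {c. lincomb c \<in> {x. p x x < r}}"
    using continuous_form_lincomb[OF frame_form_psd[OF p]]
    by (simp add: open_Collect_less)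
  show "{x. p x x < r} \<subseteq> {x. p x x \<le> r}" by (auto intro: less_imp_le)
  have "p 0 0 = 0" by (rule psd_form_0[OF frame_form_psd[OF p]])
  with r show "0 \<in> {x. p x x < r}" by simp
qed

definition euclidean_form :: "'a \<Rightarrow> 'a \<Rightarrow> real" where
  "euclidean_form x y = (\<Sum>i\<in>I. g i x * g i y)"

lemma frame_form_euclidean: "frame_form euclidean_form"
  unfolding frame_form_def psd_form_def euclidean_form_def
proof (intro conjI allI)
  show "(\<Sum>i\<in>I. g i (x + y) * g i z) = (\<Sum>i\<in>I. g i x * g i z) + (\<Sum>i\<in>I. g i y * g i z)" for x y z
    by (simp add: linear_add[OF linear_coord] distrib_right sum.distrib)
  show "(\<Sum>i\<in>I. g i (r *\<^sub>R x) * g i y) = r * (\<Sum>i\<in>I. g i x * g i y)" for r x y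
    by (simp add: linear_cmul[OF linear_coord] sum_distrib_left mult.assoc)
  show "(\<Sum>i\<in>I. g i x * g i y) = (\<Sum>i\<in>I. g i y * g i x)" for x y
    by (simp add: mult.commute)
  show "0 \<le> (\<Sum>i\<in>I. g i x * g i x)" for x by (simp add: sum_nonneg)
  show "(\<Sum>i\<in>I. g i (proj x) * g i (proj y)) = (\<Sum>i\<in>I. g i x * g i y)" for x y
    by (simp add: coord_proj)
qed

lemma euclidean_ball_finite: "emeasure vol {x. euclidean_form x x \<le> t} < \<infinity>"
proof -
  have "{x. euclidean_form x x \<le> t} \<subseteq> {x. \<forall>i\<in>I. \<bar>g i x\<bar> \<le> sqrt t}"
  proof (intro subsetI CollectI ballI)
    fix x i assume "x \<in> {x. euclidean_form x x \<le> t}" and i: "i \<in> I"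
    then have "(\<Sum>i\<in>I. g i x * g i x) \<le> t" by (simp add: euclidean_form_def)
    moreover have "g i x * g i x \<le> (\<Sum>i\<in>I. g i x * g i x)"
      using i finite_index by (intro member_le_sum) auto
    ultimately have "\<bar>g i x\<bar>\<^sup>2 \<le> t" by (simp add: power2_eq_square)
    then show "\<bar>g i x\<bar> \<le> sqrt t" by (rule real_le_rsqrt)
  qed
  from le_less_trans[OF emeasure_mono[OF this] emeasure_box_finite] show ?thesis by simp
qed

lemma scaled_frame:
  assumes "s > 0"
  shows "coordinate_frame I (\<lambda>i. s *\<^sub>R e i) (\<lambda>i x. g i x / s)"
proof (rule coordinate_frame.intro)
  show "linear (\<lambda>x. g i x / s)" for i
    by (rule linearI) (simp_all add: linear_add[OF linear_coord] linear_cmul[OF linear_coord] add_divide_distrib)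
  show "g i (s *\<^sub>R e j) / s = (if i = j then 1 else 0)" if "i \<in> I" "j \<in> I" for i j
    using assms by (simp add: linear_cmul[OF linear_coord] coord_e[OF that])
qed (rule finite_index)

end

section \<open>Independence of volume from the basis\<close>

text \<open>Both volumes are invariant under translations by the common span. The unit cube of the second frame is
  symmetric and has positive finite measure for both, which makes the proportionality factor finite
  and nonzero. The volume of one subspace for two bases, its image under a dilation, and its image
  under an isometry are all compared by this lemma; determinants do not occur.\<close>

lemma coordinate_frames_proportional:
  fixes e :: "'i \<Rightarrow> 'a::real_vector" and e' :: "'j \<Rightarrow> 'a"
  assumes "coordinate_frame I e g" "coordinate_frame J e' g'"
    and span: "span (e ` I) = span (e' ` J)"
  obtains c where "0 < c" "c < \<infinity>"
    "\<And>B. B \<in> sets functional_algebra \<Longrightarrow>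
       emeasure (coordinate_frame.vol I e) B = c * emeasure (coordinate_frame.vol J e') B"
proof -
  interpret F: coordinate_frame I e g by fact
  interpret G: coordinate_frame J e' g' by fact
  define A where "A = {x. \<forall>j\<in>J. \<bar>g' j x\<bar> \<le> 1}"
  define U where "U = {x. \<forall>j\<in>J. \<bar>g' j x\<bar> < 1}"
  have A: "A \<in> sets functional_algebra" unfolding A_def by (rule G.box_measurable)
  have "{x \<in> space functional_algebra. \<forall>j\<in>J. \<bar>g' j x\<bar> < 1} \<in> sets functional_algebra"
    using G.finite_index by measurable
  then have U: "U \<in> sets functional_algebra" by (simp add: U_def)
  have g0: "g' j 0 = 0" for j by (rule linear_0[OF G.linear_coord])
  have sub: "U \<subseteq> A" "0 \<in> U" by (auto simp: A_def U_def g0 less_imp_le)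
  have openU: "{c. h c \<in> U} = (\<Inter>j\<in>J. {c. \<bar>g' j (h c)\<bar> < 1})" for h :: "'d \<Rightarrow> 'a"
    by (auto simp: U_def)
  have op: "open {c. F.lincomb c \<in> U}" unfolding openU
    using G.finite_index
    by (intro open_INT ballI open_Collect_less continuous_intros F.continuous_functional_lincomb G.linear_coord) auto
  have op': "open {c. G.lincomb c \<in> U}" unfolding openU
    using G.finite_index
    by (intro open_INT ballI open_Collect_less continuous_intros G.continuous_functional_lincomb G.linear_coord) auto
  have pos1: "0 < emeasure F.vol A"
    by (rule F.emeasure_pos_at_0[OF A op sub U])
  have pos2: "0 < emeasure G.vol A"
    by (rule G.emeasure_pos_at_0[OF A op' sub U])
  have fin2: "emeasure G.vol A < \<infinity>" unfolding A_def by (rule G.emeasure_box_finite)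
  have fin1: "emeasure F.vol A < \<infinity>"
  proof -
    define R where "R = (\<Sum>i\<in>I. \<Sum>j\<in>J. \<bar>g i (e' j)\<bar>)"
    have conc: "emeasure F.vol A = emeasure F.vol (F.proj -` A)"
      using emeasure_distr[of F.proj F.vol functional_algebra A] A
      by (simp add: F.distr_vol_fixed[OF F.linear_proj])
    \<comment> \<open>Coordinates of one frame are bounded on the unit cube of the other, since they are
      finite linear combinations of its coordinates.\<close>
    have "F.proj -` A \<subseteq> {x. \<forall>i\<in>I. \<bar>g i x\<bar> \<le> R}"
    proof (intro subsetI CollectI ballI)
      fix x i assume "x \<in> F.proj -` A" and i: "i \<in> I"
      define y where "y = F.proj x"
      have y: "y \<in> A" "y \<in> span (e' ` J)" using \<open>x \<in> F.proj -` A\<close> by (auto simp: y_def simp flip: span)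
      have "y = (\<Sum>j\<in>J. g' j y *\<^sub>R e' j)"
        using G.proj_span[OF y(2)] by (simp add: G.proj_def G.lincomb_def)
      then have "g i y = g i (\<Sum>j\<in>J. g' j y *\<^sub>R e' j)" by (rule arg_cong)
      also have "\<dots> = (\<Sum>j\<in>J. g' j y * g i (e' j))"
        by (simp add: linear_sum[OF F.linear_coord] linear_cmul[OF F.linear_coord])
      finally have "g i y = (\<Sum>j\<in>J. g' j y * g i (e' j))" .
      then have "\<bar>g i y\<bar> = \<bar>\<Sum>j\<in>J. g' j y * g i (e' j)\<bar>" by (rule arg_cong)
      also have "\<dots> \<le> (\<Sum>j\<in>J. \<bar>g i (e' j)\<bar>)"
      proof (rule order_trans[OF sum_abs sum_mono])
        fix j assume "j \<in> J"
        then have "\<bar>g' j y\<bar> \<le> 1" using y(1) by (simp add: A_def)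
        then show "\<bar>g' j y * g i (e' j)\<bar> \<le> \<bar>g i (e' j)\<bar>"
          by (simp add: abs_mult mult_left_le_one_le)
      qed
      also have "\<dots> \<le> R"
        unfolding R_def using i F.finite_index
        by (intro member_le_sum[where f = "\<lambda>i. \<Sum>j\<in>J. \<bar>g i (e' j)\<bar>"]) (auto intro: sum_nonneg)
      finally show "\<bar>g i x\<bar> \<le> R" using F.coord_proj[OF i] by (simp add: y_def)
    qed
    then have "emeasure F.vol (F.proj -` A) \<le> emeasure F.vol {x. \<forall>i\<in>I. \<bar>g i x\<bar> \<le> R}"
      by (intro emeasure_mono) auto
    then show ?thesis using F.emeasure_box_finite[of R] conc by simp
  qed
  have inv: "emeasure F.vol A * emeasure G.vol B = emeasure F.vol B * emeasure G.vol A"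
    if "B \<in> sets functional_algebra" for B
  proof (rule invariant_measure_proportional[where P = F.proj])
    show "distr G.vol functional_algebra F.proj = G.vol"
      by (rule G.distr_vol_fixed) (auto simp: F.linear_proj simp flip: span)
    show "distr G.vol functional_algebra (\<lambda>x. x + F.proj a) = G.vol" for a
      by (rule G.vol_translation) (auto simp flip: span)
    show "distr F.vol functional_algebra F.proj = F.vol"
      by (rule F.distr_vol_fixed) (auto simp: F.linear_proj)
    show "distr F.vol functional_algebra (\<lambda>x. x + F.proj a) = F.vol" for a
      by (rule F.vol_translation) auto
    show "- x \<in> A \<longleftrightarrow> x \<in> A" for x
      by (simp add: A_def linear_neg[OF G.linear_coord])
  qed (use that A F.sigma_finite_vol G.sigma_finite_vol F.linear_proj in auto)
  define c where "c = emeasure F.vol A / emeasure G.vol A"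
  show ?thesis
  proof
    show "0 < c" unfolding c_def using pos1 fin2 by (simp add: ennreal_zero_less_divide)
    show "c < \<infinity>" unfolding c_def using pos2 fin1
      by (auto simp: less_top[symmetric] ennreal_divide_eq_top_iff)
    fix B :: "'a set" assume B: "B \<in> sets functional_algebra"
    have "emeasure F.vol B = emeasure F.vol B * emeasure G.vol A / emeasure G.vol A"
      using pos2 fin2 by (subst ennreal_mult_divide_eq) (auto simp: less_top)
    also have "\<dots> = c * emeasure G.vol B"
      by (simp add: c_def inv[OF B, symmetric] ennreal_divide_times ennreal_times_divide mult.commute)
    finally show "emeasure F.vol B = c * emeasure G.vol B" .
  qed
qed

section \<open>Volume of an ellipsoid as a convex integral\<close>

text \<open>A nonincreasing function of \<open>t\<close> that is convex everywhere, strictly convex on \<open>[0, 1]\<close>, and zero from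
  \<open>1\<close> on. Strict convexity separates two forms, and vanishing from \<open>1\<close> on keeps integrals over
  ellipsoids finite.\<close>

definition bump :: "real \<Rightarrow> real" where
  "bump t = (max 0 (1 - t))\<^sup>2"

lemma continuous_bump: "continuous_on A bump"
  unfolding bump_def by (intro continuous_intros)

lemma measurable_bump [measurable]: "bump \<in> borel_measurable borel"
  by (rule borel_measurable_continuous_onI[OF continuous_bump])

lemma bump_convex_gap:
  "bump a + bump b \<ge> 2 * bump ((a + b) / 2) + (if a \<le> 1 \<and> b \<le> 1 then (a - b)\<^sup>2 / 2 else 0)"
proof (cases "a \<le> 1 \<and> b \<le> 1")
  case True
  then show ?thesis by (simp add: bump_def power2_eq_square field_simps)
next
  case False
  have "0 \<le> (max 0 (1 - a) - max 0 (1 - b))\<^sup>2" by simp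
  then have "((max 0 (1 - a) + max 0 (1 - b)) / 2)\<^sup>2 * 2 \<le> bump a + bump b"
    by (simp add: bump_def power2_eq_square field_simps)
  moreover have "bump ((a + b) / 2) \<le> ((max 0 (1 - a) + max 0 (1 - b)) / 2)\<^sup>2"
    unfolding bump_def by (rule power_mono) (auto simp: max_def field_simps)
  ultimately show ?thesis using False by auto
qed

lemma nn_integral_bump_layer:
  assumes "0 \<le> t"
  shows "ennreal (bump t) = (\<integral>\<^sup>+s. ennreal (2 * (1 - s)) * indicator {0..1} s * indicator {t..} s \<partial>lborel)"
proof (cases "t \<le> 1")
  case True
  have "(\<integral>\<^sup>+s. ennreal (2 * (1 - s)) * indicator {t..1} s \<partial>lborel)
      = (\<lambda>s. - ((1 - s)\<^sup>2)) 1 - (\<lambda>s. - ((1 - s)\<^sup>2)) t"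
    using True by (intro nn_integral_FTC_Icc) (auto intro!: derivative_eq_intros)
  also have "\<dots> = bump t" using True by (simp add: bump_def)
  finally have "ennreal (bump t) = (\<integral>\<^sup>+s. ennreal (2 * (1 - s)) * indicator {t..1} s \<partial>lborel)" ..
  also have "\<dots> = (\<integral>\<^sup>+s. ennreal (2 * (1 - s)) * indicator {0..1} s * indicator {t..} s \<partial>lborel)"
    using assms by (intro nn_integral_cong) (auto simp: indicator_def)
  finally show ?thesis .
next
  case False
  then have "(\<integral>\<^sup>+s. ennreal (2 * (1 - s)) * indicator {0..1} s * indicator {t..} s \<partial>lborel) = (\<integral>\<^sup>+s. 0 \<partial>(lborel :: real measure))"
    by (intro nn_integral_cong) (auto simp: indicator_def)
  then show ?thesis using False by (simp add: bump_def)
qed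

lemma measurable_emeasure_sublevel:
  fixes q :: "'a \<Rightarrow> real"
  assumes "sigma_finite_measure M" and [measurable]: "q \<in> borel_measurable M"
  shows "(\<lambda>s. emeasure M {x \<in> space M. q x \<le> s}) \<in> borel_measurable borel"
proof -
  interpret sigma_finite_measure M by fact
  have "(\<lambda>s. emeasure M {x \<in> space M. q x \<le> s}) = (\<lambda>s. \<integral>\<^sup>+x. indicator {q x..} s \<partial>M)"
  proof
    fix s
    have "(\<integral>\<^sup>+x. indicator {q x..} s \<partial>M) = (\<integral>\<^sup>+x. indicator {x \<in> space M. q x \<le> s} x \<partial>M)"
      by (intro nn_integral_cong) (auto simp: indicator_def)
    then show "emeasure M {x \<in> space M. q x \<le> s} = (\<integral>\<^sup>+x. indicator {q x..} s \<partial>M)" by simp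
  qed
  also have "\<dots> \<in> borel_measurable borel"
  proof (rule borel_measurable_nn_integral)
    have "(\<lambda>(s, x). indicator {q x..} s) = (\<lambda>z. indicator {z. q (snd z) \<le> fst z} z :: ennreal)"
      by (auto simp: indicator_def)
    also have "\<dots> \<in> borel_measurable (borel \<Otimes>\<^sub>M M)"
      by (rule borel_measurable_indicator') measurable
    finally show "(\<lambda>(s, x). indicator {q x..} s :: ennreal) \<in> borel_measurable (borel \<Otimes>\<^sub>M M)" .
  qed
  finally show ?thesis .
qed

text \<open>This writes the integral of \<open>bump \<circ> q\<close> as a weighted average of the volumes of the sublevel sets
  of \<open>q\<close>, because \<open>bump t\<close> is the integral of \<open>2 (1 - s)\<close> over \<open>[t, 1]\<close>.\<close>

lemma layer_cake_bump:
  fixes q :: "'a \<Rightarrow> real"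
  assumes "sigma_finite_measure M" and q: "q \<in> borel_measurable M" "\<And>x. 0 \<le> q x"
  shows "(\<integral>\<^sup>+x. ennreal (bump (q x)) \<partial>M) =
    (\<integral>\<^sup>+s. ennreal (2 * (1 - s)) * indicator {0..1} s * emeasure M {x \<in> space M. q x \<le> s} \<partial>lborel)"
proof -
  interpret sigma_finite_measure M by fact
  interpret pair_sigma_finite M "lborel :: real measure" by standard
  note [measurable] = q(1)
  have meas: "(\<lambda>(x, s). ennreal (2 * (1 - s)) * indicator {0..1} s * indicator {q x..} s) \<in> borel_measurable (M \<Otimes>\<^sub>M lborel)"
  proof -
    have "(\<lambda>(x, s). ennreal (2 * (1 - s)) * indicator {0..1} s * indicator {q x..} s)
      = (\<lambda>z. ennreal (2 * (1 - snd z)) * indicator {0..1} (snd z) * (if q (fst z) \<le> snd z then 1 else 0))"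
      by (auto simp: indicator_def)
    then show ?thesis by simp
  qed
  have "(\<integral>\<^sup>+x. ennreal (bump (q x)) \<partial>M)
     = (\<integral>\<^sup>+x. \<integral>\<^sup>+s. ennreal (2 * (1 - s)) * indicator {0..1} s * indicator {q x..} s \<partial>lborel \<partial>M)"
    by (simp add: nn_integral_bump_layer[OF q(2)])
  also have "\<dots> = (\<integral>\<^sup>+s. \<integral>\<^sup>+x. ennreal (2 * (1 - s)) * indicator {0..1} s * indicator {q x..} s \<partial>M \<partial>lborel)"
    by (rule Fubini'[symmetric]) (rule meas)
  also have "\<dots> = (\<integral>\<^sup>+s. ennreal (2 * (1 - s)) * indicator {0..1} s * emeasure M {x \<in> space M. q x \<le> s} \<partial>lborel)"
  proof (rule nn_integral_cong)
    fix s :: real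
    have "(\<integral>\<^sup>+x. ennreal (2 * (1 - s)) * indicator {0..1} s * indicator {q x..} s \<partial>M)
      = (\<integral>\<^sup>+x. ennreal (2 * (1 - s)) * indicator {0..1} s * indicator {x \<in> space M. q x \<le> s} x \<partial>M)"
      by (intro nn_integral_cong) (auto simp: indicator_def)
    also have "\<dots> = ennreal (2 * (1 - s)) * indicator {0..1} s * emeasure M {x \<in> space M. q x \<le> s}"
      by (rule nn_integral_cmult_indicator) measurable
    finally show "(\<integral>\<^sup>+x. ennreal (2 * (1 - s)) * indicator {0..1} s * indicator {q x..} s \<partial>M)
      = ennreal (2 * (1 - s)) * indicator {0..1} s * emeasure M {x \<in> space M. q x \<le> s}" .
  qed
  finally show ?thesis .
qed

context coordinate_frame
begin

text \<open>The dilated basis is again a frame of the same subspace. The factor, \<open>s\<close> to the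
  power of minus the dimension, is the same for all sets.\<close>

lemma vol_dilation:
  assumes s: "s > 0"
  obtains c where "\<And>B. B \<in> sets functional_algebra \<Longrightarrow> emeasure vol {x. s *\<^sub>R x \<in> B} = c * emeasure vol B"
proof -
  interpret S: coordinate_frame I "\<lambda>i. s *\<^sub>R e i" "\<lambda>i x. g i x / s" by (rule scaled_frame[OF s])
  have "span ((\<lambda>i. s *\<^sub>R e i) ` I) = span (e ` I)"
  proof
    show "span ((\<lambda>i. s *\<^sub>R e i) ` I) \<subseteq> span (e ` I)"
      by (rule span_minimal) (auto intro: span_scale e_in_span)
    have "e i \<in> span ((\<lambda>i. s *\<^sub>R e i) ` I)" if "i \<in> I" for i
      using span_scale[OF S.e_in_span[OF that], of "1 / s"] s by simp
    then show "span (e ` I) \<subseteq> span ((\<lambda>i. s *\<^sub>R e i) ` I)"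
      by (intro span_minimal) auto
  qed
  then obtain c where c: "\<And>B. B \<in> sets functional_algebra \<Longrightarrow> emeasure S.vol B = c * emeasure vol B"
    using coordinate_frames_proportional[OF S.coordinate_frame_axioms coordinate_frame_axioms] by blast
  have "emeasure vol {x. s *\<^sub>R x \<in> B} = c * emeasure vol B" if B: "B \<in> sets functional_algebra" for B
  proof -
    have "linear (\<lambda>x::'a. s *\<^sub>R x)" by (auto intro: linearI simp: scaleR_add_right)
    from measurable_sets[OF measurable_linear[OF this] B]
    have "{x. s *\<^sub>R x \<in> B} \<in> sets functional_algebra" by (simp add: vimage_def)
    moreover have "S.lincomb c = s *\<^sub>R lincomb c" for c
      by (simp add: S.lincomb_def lincomb_def scaleR_sum_right mult.commute)
    ultimately have "emeasure vol {x. s *\<^sub>R x \<in> B} = emeasure S.vol B"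
      using B by (simp add: emeasure_vol S.emeasure_vol)
    then show ?thesis using c[OF B] by simp
  qed
  then show thesis by (rule that)
qed

definition unit_volume :: "('a \<Rightarrow> 'a \<Rightarrow> real) \<Rightarrow> ennreal" where
  "unit_volume p = emeasure vol {x. p x x \<le> 1}"

definition bump_integral :: "('a \<Rightarrow> 'a \<Rightarrow> real) \<Rightarrow> ennreal" where
  "bump_integral p = (\<integral>\<^sup>+x. ennreal (bump (p x x)) \<partial>vol)"

text \<open>The sublevel set of level \<open>t\<close> is the unit sublevel set dilated by \<open>sqrt t\<close>, and the dilation factor is
  the same for all forms.\<close>

lemma sublevel_ratio:
  assumes p: "frame_form p" and q: "frame_form q" and t: "t > 0"
  shows "emeasure vol {x. p x x \<le> t} * unit_volume q = unit_volume p * emeasure vol {x. q x x \<le> t}"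
proof -
  obtain c where c: "\<And>B. B \<in> sets functional_algebra \<Longrightarrow> emeasure vol {x. sqrt t *\<^sub>R x \<in> B} = c * emeasure vol B"
    using vol_dilation[of "sqrt t"] t by auto
  have *: "unit_volume p = c * emeasure vol {x. p x x \<le> t}" if p: "frame_form p" for p
  proof -
    from c[OF sublevel_measurable[OF p, of t]] show ?thesis
      using t by (simp add: unit_volume_def psd_form_scale[OF frame_form_psd[OF p]] mult.assoc[symmetric])
  qed
  show ?thesis by (simp add: *[OF p] *[OF q] mult_ac)
qed

lemma bump_integral_ratio:
  assumes p: "frame_form p" and q: "frame_form q"
  shows "bump_integral p * unit_volume q = unit_volume p * bump_integral q"
proof -
  have layers: "bump_integral p = (\<integral>\<^sup>+s. ennreal (2 * (1 - s)) * indicator {0..1} s * emeasure vol {x. p x x \<le> s} \<partial>lborel)"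
    if "frame_form p" for p
    using layer_cake_bump[OF sigma_finite_vol, of "\<lambda>x. p x x"] measurable_frame_form[OF that]
      psd_form_nonneg[OF frame_form_psd[OF that]] by (simp add: bump_integral_def)
  have [measurable]: "(\<lambda>s. emeasure vol {x. p x x \<le> s}) \<in> borel_measurable borel" if "frame_form p" for p
    using measurable_emeasure_sublevel[OF sigma_finite_vol, of "\<lambda>x. p x x"] measurable_frame_form[OF that] by simp
  have "bump_integral p * unit_volume q = (\<integral>\<^sup>+s. ennreal (2 * (1 - s)) * indicator {0..1} s * emeasure vol {x. p x x \<le> s} * unit_volume q \<partial>lborel)"
    unfolding layers[OF p] using p by (subst nn_integral_multc) auto
  also have "\<dots> = (\<integral>\<^sup>+s. unit_volume p * (ennreal (2 * (1 - s)) * indicator {0..1} s * emeasure vol {x. q x x \<le> s}) \<partial>lborel)"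
  proof (rule nn_integral_cong_AE)
    show "AE s in lborel. ennreal (2 * (1 - s)) * indicator {0..1} s * emeasure vol {x. p x x \<le> s} * unit_volume q
        = unit_volume p * (ennreal (2 * (1 - s)) * indicator {0..1} s * emeasure vol {x. q x x \<le> s})"
      using AE_lborel_singleton[of "0::real"]
    proof eventually_elim
      case (elim s)
      show ?case
      proof (cases "s > 0")
        case True
        then show ?thesis
          unfolding mult.assoc sublevel_ratio[OF p q True] by (simp only: mult.left_commute)
      next
        case False
        then show ?thesis using elim by simp
      qed
    qed
  qed
  also have "\<dots> = unit_volume p * bump_integral q"
    unfolding layers[OF q] using q by (subst nn_integral_cmult) auto
  finally show ?thesis .
qed

lemma unit_volume_euclidean: "0 < unit_volume euclidean_form" "unit_volume euclidean_form < \<infinity>"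
  unfolding unit_volume_def using frame_form_sublevel_pos[OF frame_form_euclidean, of 1] euclidean_ball_finite by auto

lemma bump_integral_le_unit_volume:
  assumes p: "frame_form p"
  shows "bump_integral p \<le> unit_volume p"
proof -
  note [measurable] = measurable_frame_form[OF p]
  have m: "{x. p x x \<le> 1} \<in> sets functional_algebra" by (rule sublevel_measurable[OF p])
  have "ennreal (bump (p x x)) \<le> indicator {x. p x x \<le> 1} x" for x
    using psd_form_nonneg[OF frame_form_psd[OF p], of x]
    by (auto simp: indicator_def bump_def power_le_one)
  then have "bump_integral p \<le> (\<integral>\<^sup>+x. indicator {x. p x x \<le> 1} x \<partial>vol)"
    unfolding bump_integral_def by (intro nn_integral_mono)
  then show ?thesis using m by (simp add: unit_volume_def)
qed

lemma bump_integral_pos: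
  assumes p: "frame_form p"
  shows "0 < bump_integral p"
proof -
  note [measurable] = measurable_frame_form[OF p]
  have m: "{x. p x x \<le> 1/2} \<in> sets functional_algebra" by (rule sublevel_measurable[OF p])
  have "ennreal (1/4) * indicator {x. p x x \<le> 1/2} x \<le> ennreal (bump (p x x))" for x
  proof (cases "p x x \<le> 1/2")
    case True
    have "(1/2)\<^sup>2 \<le> bump (p x x)" unfolding bump_def using True by (intro power_mono) auto
    then show ?thesis using True by (simp add: power2_eq_square)
  qed simp
  then have "(\<integral>\<^sup>+x. ennreal (1/4) * indicator {x. p x x \<le> 1/2} x \<partial>vol) \<le> bump_integral p"
    unfolding bump_integral_def by (intro nn_integral_mono)
  moreover have "0 < ennreal (1/4) * emeasure vol {x. p x x \<le> 1/2}"
    using frame_form_sublevel_pos[OF p, of "1/2"] by (simp add: ennreal_zero_less_mult_iff)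
  ultimately show ?thesis using m by (simp add: nn_integral_cmult_indicator)
qed

text \<open>Averaging the preceding ratio over levels shows that, up to a constant, the volume of an ellipsoid is
  the integral of \<open>bump\<close> along its form. Minimising volume thus becomes minimising a functional that
  is visibly convex in the form and continuous enough for Fatou's lemma.\<close>

lemma bump_integral_proportional:
  obtains K where "0 < K" "K < \<infinity>" "\<And>p. frame_form p \<Longrightarrow> bump_integral p = K * unit_volume p"
proof
  let ?K = "bump_integral euclidean_form / unit_volume euclidean_form"
  show "0 < ?K"
    using unit_volume_euclidean bump_integral_pos[OF frame_form_euclidean] by (simp add: ennreal_zero_less_divide)
  show "?K < \<infinity>"
    using unit_volume_euclidean bump_integral_le_unit_volume[OF frame_form_euclidean]
    by (auto simp: less_top[symmetric] ennreal_divide_eq_top_iff top_unique)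
  show "bump_integral p = ?K * unit_volume p" if p: "frame_form p" for p
  proof -
    have "bump_integral p = bump_integral p * unit_volume euclidean_form / unit_volume euclidean_form"
      using unit_volume_euclidean by (subst ennreal_mult_divide_eq) auto
    also have "\<dots> = ?K * unit_volume p"
      by (simp add: bump_integral_ratio[OF p frame_form_euclidean] ennreal_divide_times ennreal_times_divide mult.commute)
    finally show ?thesis .
  qed
qed

lemma open_form_discrepancy:
  assumes "frame_form p" "frame_form q" 
  shows "open {c. lincomb c \<in> {x. p x x < 1 \<and> q x x < 1 \<and> p x x \<noteq> q x x}}"
  using continuous_form_lincomb[OF frame_form_psd[OF assms(1)]] continuous_form_lincomb[OF frame_form_psd[OF assms(2)]]
  by (auto intro!: open_Collect_conj open_Collect_less open_Collect_neq)

text \<open>If two forms have the same finite volume, then by strict convexity of \<open>bump\<close> their mean has a smaller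
  \<open>bump\<close> integral, hence a smaller volume, unless the forms agree almost everywhere on the
  intersection of their unit balls. By continuity and homogeneity they then agree everywhere.\<close>

lemma minimal_form_unique:
  assumes p: "frame_form p" and q: "frame_form q"
    and eq: "unit_volume p = unit_volume q" and fin: "unit_volume p < \<infinity>"
    and le: "unit_volume p \<le> unit_volume (\<lambda>x y. (p x y + q x y) / 2)"
  shows "p x x = q x x"
proof -
  define m where "m = (\<lambda>x y. (p x y + q x y) / 2)"
  define D where "D = (\<lambda>x. if p x x \<le> 1 \<and> q x x \<le> 1 then (p x x - q x x)\<^sup>2 / 2 else 0)"
  have m: "frame_form m"
    using p q unfolding frame_form_def psd_form_def m_def by (auto simp: field_simps)
  note [measurable] = measurable_frame_form[OF p] measurable_frame_form[OF q] measurable_frame_form[OF m]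
  have [measurable]: "D \<in> borel_measurable functional_algebra" unfolding D_def by measurable
  obtain K where K: "0 < K" "K < \<infinity>" "\<And>p. frame_form p \<Longrightarrow> bump_integral p = K * unit_volume p"
    by (rule bump_integral_proportional) blast
  have Hfin: "bump_integral p < \<infinity>" using bump_integral_le_unit_volume[OF p] fin by (rule le_less_trans)
  have Hpq: "bump_integral q = bump_integral p" using K(3)[OF p] K(3)[OF q] eq by simp
  have Hm: "bump_integral p \<le> bump_integral m" using K(3)[OF p] K(3)[OF m] le by (simp add: m_def mult_left_mono)
  have D0: "0 \<le> D x" for x by (simp add: D_def)
  have "2 * bump_integral m + (\<integral>\<^sup>+x. ennreal (D x) \<partial>vol) = (\<integral>\<^sup>+x. 2 * ennreal (bump (m x x)) + ennreal (D x) \<partial>vol)"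
    unfolding bump_integral_def by (simp add: nn_integral_add nn_integral_cmult)
  also have "\<dots> \<le> (\<integral>\<^sup>+x. ennreal (bump (p x x)) + ennreal (bump (q x x)) \<partial>vol)"
  proof (rule nn_integral_mono)
    fix x
    have "2 * bump (m x x) + D x \<le> bump (p x x) + bump (q x x)"
      using bump_convex_gap[of "p x x" "q x x"] by (simp add: m_def D_def)
    then have "ennreal (2 * bump (m x x) + D x) \<le> ennreal (bump (p x x) + bump (q x x))"
      by (rule ennreal_leI)
    then show "2 * ennreal (bump (m x x)) + ennreal (D x) \<le> ennreal (bump (p x x)) + ennreal (bump (q x x))"
      using D0[of x] by (simp add: ennreal_plus ennreal_mult bump_def)
  qed
  also have "\<dots> = 2 * bump_integral p" unfolding mult_2 using Hpq
    by (simp add: nn_integral_add bump_integral_def)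
  finally have "2 * bump_integral m + (\<integral>\<^sup>+x. ennreal (D x) \<partial>vol) \<le> 2 * bump_integral p" .
  moreover have "2 * bump_integral p + (\<integral>\<^sup>+x. ennreal (D x) \<partial>vol) \<le> 2 * bump_integral m + (\<integral>\<^sup>+x. ennreal (D x) \<partial>vol)"
    by (intro add_right_mono mult_left_mono Hm) simp
  ultimately have "2 * bump_integral p + (\<integral>\<^sup>+x. ennreal (D x) \<partial>vol) \<le> 2 * bump_integral p + 0"
    by (simp only: add_0_right)
  then have "(\<integral>\<^sup>+x. ennreal (D x) \<partial>vol) = 0"
    using Hfin by (subst (asm) ennreal_add_left_cancel_le) (auto simp: ennreal_mult_eq_top_iff)
  then have AE: "AE x in vol. ennreal (D x) = 0"
    by (subst (asm) nn_integral_0_iff_AE) auto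
  define N where "N = {x. p x x < 1 \<and> q x x < 1 \<and> p x x \<noteq> q x x}"
  have "{x \<in> space functional_algebra. p x x < 1 \<and> q x x < 1 \<and> p x x \<noteq> q x x} \<in> sets functional_algebra"
    by measurable
  then have N: "N \<in> sets functional_algebra" by (simp add: N_def)
  have "AE x in vol. x \<notin> N"
    using AE by eventually_elim (use D0 in \<open>auto simp: N_def D_def ennreal_eq_0_iff split: if_splits\<close>)
  then have N0: "emeasure vol N = 0"
    using N by (subst (asm) AE_iff_measurable[of N]) auto
  show ?thesis
  proof (rule ccontr)
    assume neq: "p x x \<noteq> q x x"
    \<comment> \<open>Shrinking a point of disagreement moves it into both open unit balls.\<close>
    define t where "t = 1 / (1 + p x x + q x x)"
    have nn: "0 \<le> p x x" "0 \<le> q x x" by (simp_all add: psd_form_nonneg frame_form_psd p q)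
    define y where "y = t *\<^sub>R proj x"
    have t: "0 < t" "t \<le> 1" "t * p x x < 1" "t * q x x < 1"
      using nn by (auto simp: t_def field_simps)
    have pq: "p y y = t * (t * p x x)" "q y y = t * (t * q x x)"
      using p q by (simp_all add: y_def psd_form_scale[OF frame_form_psd[OF p]] psd_form_scale[OF frame_form_psd[OF q]] frame_form_def)
    have "t * (t * p x x) < 1" "t * (t * q x x) < 1"
      using t nn by (smt (verit) mult_left_le_one_le mult_nonneg_nonneg)+
    then have "y \<in> N" using neq t(1) by (simp add: N_def pq)
    have "0 < emeasure vol N"
    proof (rule emeasure_open_pos[OF N _ \<open>y \<in> N\<close>])
      show "open {c. lincomb c \<in> N}" unfolding N_def by (rule open_form_discrepancy[OF p q])
      show "y \<in> span (e ` I)" by (simp add: y_def span_scale)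
    qed
    then show False using N0 by simp
  qed
qed

end

section \<open>Existence of a form of minimal volume\<close>

lemma convergent_subsequence_finite:
  fixes a :: "nat \<Rightarrow> 's \<Rightarrow> real"
  assumes "finite S" and "\<And>s n. s \<in> S \<Longrightarrow> \<bar>a n s\<bar> \<le> M s"
  obtains r l where "strict_mono r" "\<And>s. s \<in> S \<Longrightarrow> (\<lambda>n. a (r n) s) \<longlonglongrightarrow> l s"
proof -
  have "\<exists>r l. strict_mono r \<and> (\<forall>s\<in>S. (\<lambda>n. a (r n) s) \<longlonglongrightarrow> l s)"
    using assms
  proof (induction S rule: finite_induct)
    case empty
    show ?case by (auto intro: exI[of _ "\<lambda>n. n"] simp: strict_mono_def)
  next
    case (insert s S)
    then obtain r l where r: "strict_mono r" "\<forall>s\<in>S. (\<lambda>n. a (r n) s) \<longlonglongrightarrow> l s" by auto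
    have "bounded (range (\<lambda>n. a (r n) s))"
      using insert.prems[of s] by (auto simp: bounded_iff intro!: exI[of _ "M s"])
    then obtain l' r' where r': "strict_mono r'" "((\<lambda>n. a (r n) s) \<circ> r') \<longlonglongrightarrow> l'"
      using bounded_imp_convergent_subsequence by blast
    have "(\<lambda>n. a (r (r' n)) t) \<longlonglongrightarrow> (l(s := l')) t" if "t \<in> insert s S" for t
    proof (cases "t = s")
      case True
      then show ?thesis using r'(2) by (simp add: o_def)
    next
      case False
      then have "(\<lambda>n. a (r n) t) \<longlonglongrightarrow> l t" using r(2) that by auto
      from LIMSEQ_subseq_LIMSEQ[OF this r'(1)] False show ?thesis by (simp add: o_def)
    qed
    moreover have "strict_mono (r \<circ> r')" using r(1) r'(1) by (rule strict_mono_o)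
    ultimately show ?case
      by (intro exI[of _ "r \<circ> r'"] exI[of _ "l(s := l')"]) (simp only: o_def, blast)
  qed
  then show thesis using that by blast
qed

context coordinate_frame
begin

text \<open>The unit ball of a form with a null vector is invariant under translations along that vector. It
  contains infinitely many disjoint translates of one slab of positive measure.\<close>

lemma unit_volume_degenerate:
  assumes p: "frame_form p" and w: "w \<in> span (e ` I)" "w \<noteq> 0" "p w w = 0"
  shows "unit_volume p = \<infinity>"
proof (rule ccontr)
  assume "unit_volume p \<noteq> \<infinity>"
  then obtain v where v: "unit_volume p = ennreal v" "0 \<le> v" by (cases "unit_volume p") auto
  note psd = frame_form_psd[OF p]
  have "\<exists>b\<in>I. g b w \<noteq> 0"
  proof (rule ccontr)
    assume "\<not> (\<exists>b\<in>I. g b w \<noteq> 0)"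
    then have "proj w = 0" by (simp add: proj_def lincomb_def)
    then show False using w proj_span[OF w(1)] by simp
  qed
  then obtain b where b: "b \<in> I" "g b w \<noteq> 0" by blast
  \<comment> \<open>Normalised so that translation by \<open>u\<close> raises the coordinate \<open>b\<close> by one.\<close>
  define u where "u = (1 / g b w) *\<^sub>R w"
  have u: "u \<in> span (e ` I)" "g b u = 1" "p u u = 0"
    using w b by (auto simp: u_def span_scale linear_cmul[OF linear_coord] psd_form_scale[OF psd])
  have pu: "p (x + k *\<^sub>R u) (x + k *\<^sub>R u) = p x x" for x k
    using psd_form_null_vector[OF psd u(3), of x] psd_form_sym[OF psd, of u x] u(3)
    by (simp add: psd_form_add[OF psd] psd_form_scale[OF psd])
  define S where "S = (\<lambda>k::nat. {x. p x x \<le> 1 \<and> real k \<le> g b x \<and> g b x < real k + 1})"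
  note [measurable] = measurable_frame_form[OF p]
  have "{x \<in> space functional_algebra. p x x \<le> 1 \<and> real k \<le> g b x \<and> g b x < real k + 1} \<in> sets functional_algebra" for k
    by measurable
  then have S [measurable]: "S k \<in> sets functional_algebra" for k by (simp add: S_def)
  have A: "{x. p x x \<le> 1} \<in> sets functional_algebra" by (rule sublevel_measurable[OF p])
  have Sk: "emeasure vol (S k) = emeasure vol (S 0)" for k
  proof -
    have "emeasure vol (S k) = emeasure (distr vol functional_algebra (\<lambda>x. x + real k *\<^sub>R u)) (S k)"
      using u(1) by (simp add: vol_translation span_scale)
    also have "\<dots> = emeasure vol {x. x + real k *\<^sub>R u \<in> S k}"
      by (subst emeasure_distr) (auto simp: vimage_def)
    also have "{x. x + real k *\<^sub>R u \<in> S k} = S 0"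
      by (auto simp: S_def pu linear_add[OF linear_coord] linear_cmul[OF linear_coord] u)
    finally show ?thesis .
  qed
  have disj: "disjoint_family S"
    unfolding disjoint_family_on_def by (auto simp: S_def)
  have bound: "of_nat n * emeasure vol (S 0) \<le> unit_volume p" for n
  proof -
    have "of_nat n * emeasure vol (S 0) = (\<Sum>k<n. emeasure vol (S 0))" by simp
    also have "\<dots> = (\<Sum>k<n. emeasure vol (S k))" by (rule sum.cong[OF refl Sk[symmetric]])
    also have "\<dots> = emeasure vol (\<Union>k<n. S k)"
      using disj by (intro sum_emeasure) (auto intro: disjoint_family_on_mono[of _ UNIV])
    also have "\<dots> \<le> unit_volume p"
      unfolding unit_volume_def using A by (intro emeasure_mono) (auto simp: S_def)
    finally show ?thesis .
  qed
  define N where "N = {x. p x x < 1 \<and> 0 < g b x \<and> g b x < 1}"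
  have "{x \<in> space functional_algebra. p x x < 1 \<and> 0 < g b x \<and> g b x < 1} \<in> sets functional_algebra"
    by measurable
  then have N: "N \<in> sets functional_algebra" by (simp add: N_def)
  have "0 < emeasure vol N"
  proof (rule emeasure_open_pos[OF N])
    show "open {c. lincomb c \<in> N}"
      using continuous_form_lincomb[OF psd] continuous_functional_lincomb[OF linear_coord[of b]]
      unfolding N_def by (auto intro!: open_Collect_conj open_Collect_less)
    show "(1/2) *\<^sub>R u \<in> N" "(1/2) *\<^sub>R u \<in> span (e ` I)"
      using u by (auto simp: N_def psd_form_scale[OF psd] linear_cmul[OF linear_coord] span_scale)
  qed
  also have "emeasure vol N \<le> emeasure vol (S 0)"
  proof (rule emeasure_mono)
    show "N \<subseteq> S 0" by (auto simp: N_def S_def)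
  qed simp
  finally have pos: "0 < emeasure vol (S 0)" .
  have "emeasure vol (S 0) \<le> unit_volume p" using bound[of 1] by simp
  then obtain s where s: "emeasure vol (S 0) = ennreal s" "0 < s"
    using v pos by (cases "emeasure vol (S 0)") (auto simp: top_unique)
  obtain n where n: "v < real n * s" using reals_Archimedean3[OF s(2)] by blast
  have "ennreal (real n * s) \<le> ennreal v"
    using bound[of n] s by (simp add: v ennreal_mult ennreal_of_nat_eq_real_of_nat)
  then show False using n v(2) by (simp add: ennreal_le_iff)
qed

lemma frame_form_inner_product:
  assumes q: "frame_form q" and "unit_volume q < \<infinity>"
  shows "inner_product_on (span (e ` I)) q"
proof -
  have "0 < q x x" if "x \<in> span (e ` I)" "x \<noteq> 0" for x
    using unit_volume_degenerate[OF q that] assms(2) psd_form_nonneg[OF frame_form_psd[OF q], of x]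
    by (auto simp: less_le)
  then show ?thesis
    using frame_form_psd[OF q] unfolding psd_form_def inner_product_on_def by auto
qed

text \<open>The direct method. Polarization bounds the matrix entries of a minimising sequence of forms, a
  subsequence converges, and Fatou's lemma for the \<open>bump\<close> integrals shows that the limit has no larger
  volume. The limit of inner products is only positive semidefinite, which is why the minimum is taken
  over semidefinite forms; a form of finite volume is definite anyway. The constraint \<open>N\<close> is an
  arbitrary function, in the application the squared norm.\<close>

lemma minimal_form_exists:
  assumes p0: "frame_form p0" "\<And>x. x \<in> span (e ` I) \<Longrightarrow> p0 x x \<le> N x" "unit_volume p0 < \<infinity>"
  obtains p where "frame_form p" "\<And>x. x \<in> span (e ` I) \<Longrightarrow> p x x \<le> N x" "unit_volume p < \<infinity>"
    "\<And>q. frame_form q \<Longrightarrow> (\<And>x. x \<in> span (e ` I) \<Longrightarrow> q x x \<le> N x) \<Longrightarrow> unit_volume p \<le> unit_volume q"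
proof -
  define P where "P = {q. frame_form q \<and> (\<forall>x\<in>span (e ` I). q x x \<le> N x)}"
  define v where "v = Inf (unit_volume ` P)"
  have "p0 \<in> P" using p0 by (simp add: P_def)
  then have "unit_volume ` P \<noteq> {}" by blast
  from ennreal_Inf_countable_INF[OF this] obtain f where f: "decseq f" "range f \<subseteq> unit_volume ` P" "v = (INF i. f i)"
    unfolding v_def by blast
  then have "\<forall>k. \<exists>q\<in>P. f k = unit_volume q" by blast
  then obtain q where q: "\<And>k. q k \<in> P" "\<And>k. f k = unit_volume (q k)" by metis
  have Vq: "(\<lambda>k. unit_volume (q k)) \<longlonglongrightarrow> v"
    using LIMSEQ_INF[OF f(1)] unfolding f(3) q(2) .
  have qf: "frame_form (q k)" and qN: "\<And>x. x \<in> span (e ` I) \<Longrightarrow> q k x x \<le> N x" for k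
    using q(1)[of k] by (auto simp: P_def)
  have bnd: "\<bar>q k (e (fst ij)) (e (snd ij))\<bar> \<le> N (e (fst ij) + e (snd ij)) + N (e (fst ij)) + N (e (snd ij))"
    if "ij \<in> I \<times> I" for ij k
  proof -
    define x y where "x = e (fst ij)" and "y = e (snd ij)"
    have xy: "x \<in> span (e ` I)" "y \<in> span (e ` I)" "x + y \<in> span (e ` I)"
      using that by (auto simp: x_def y_def intro!: e_in_span span_add)
    have "0 \<le> q k x x" "0 \<le> q k y y" "0 \<le> q k (x + y) (x + y)"
      by (simp_all add: psd_form_nonneg frame_form_psd qf)
    then show ?thesis
      using psd_form_polarization[OF frame_form_psd[OF qf[of k]], of x y] qN[OF xy(1), of k] qN[OF xy(2), of k] qN[OF xy(3), of k]
      unfolding x_def[symmetric] y_def[symmetric] by (simp add: abs_le_iff)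
  qed
  obtain r l where r: "strict_mono r" and l: "\<And>ij. ij \<in> I \<times> I \<Longrightarrow> (\<lambda>k. q (r k) (e (fst ij)) (e (snd ij))) \<longlonglongrightarrow> l ij"
    using convergent_subsequence_finite[of "I \<times> I" "\<lambda>k ij. q k (e (fst ij)) (e (snd ij))"
      "\<lambda>ij. N (e (fst ij) + e (snd ij)) + N (e (fst ij)) + N (e (snd ij))"] finite_index bnd by auto
  define p where "p = (\<lambda>x y. \<Sum>i\<in>I. \<Sum>j\<in>I. g i x * g j y * l (i, j))"
  have lim: "(\<lambda>k. q (r k) x y) \<longlonglongrightarrow> p x y" for x y
  proof -
    have "(\<lambda>k. q (r k) x y) = (\<lambda>k. \<Sum>i\<in>I. \<Sum>j\<in>I. g i x * g j y * q (r k) (e i) (e j))"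
      by (rule ext) (rule frame_form_coords[OF qf])
    also have "\<dots> \<longlonglongrightarrow> p x y"
      unfolding p_def using l by (intro tendsto_sum tendsto_mult tendsto_const) auto
    finally show ?thesis .
  qed
  have pf: "frame_form p"
    unfolding p_def
  proof (rule frame_form_matrix)
    fix i j assume ij: "i \<in> I" "j \<in> I"
    have "(\<lambda>k. q (r k) (e i) (e j)) \<longlonglongrightarrow> l (i, j)" "(\<lambda>k. q (r k) (e j) (e i)) \<longlonglongrightarrow> l (j, i)"
      using l[of "(i, j)"] l[of "(j, i)"] ij by auto
    moreover have "q (r k) (e i) (e j) = q (r k) (e j) (e i)" for k
      by (rule psd_form_sym[OF frame_form_psd[OF qf]])
    ultimately show "l (i, j) = l (j, i)" by (auto intro: LIMSEQ_unique)
  next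
    fix c
    have "(\<lambda>k. q (r k) (lincomb c) (lincomb c)) \<longlonglongrightarrow> p (lincomb c) (lincomb c)" by (rule lim)
    then have "0 \<le> p (lincomb c) (lincomb c)"
      by (rule LIMSEQ_le_const) (auto simp: psd_form_nonneg frame_form_psd qf)
    then show "0 \<le> (\<Sum>i\<in>I. \<Sum>j\<in>I. c i * c j * l (i, j))" by (simp add: p_def coord_lincomb)
  qed
  have pN: "p x x \<le> N x" if "x \<in> span (e ` I)" for x
    using lim[of x x] by (rule LIMSEQ_le_const2) (auto simp: qN that)
  obtain K where K: "0 < K" "K < \<infinity>" "\<And>p. frame_form p \<Longrightarrow> bump_integral p = K * unit_volume p"
    by (rule bump_integral_proportional) blast
  have "bump_integral p = (\<integral>\<^sup>+x. liminf (\<lambda>k. ennreal (bump (q (r k) x x))) \<partial>vol)"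
    unfolding bump_integral_def
  proof (rule nn_integral_cong)
    fix x
    have "isCont bump (p x x)" using continuous_bump[of UNIV] by (simp add: continuous_on_eq_continuous_at)
    from isCont_tendsto_compose[OF this lim]
    have "(\<lambda>k. ennreal (bump (q (r k) x x))) \<longlonglongrightarrow> ennreal (bump (p x x))"
      by (intro tendsto_ennrealI)
    then show "ennreal (bump (p x x)) = liminf (\<lambda>k. ennreal (bump (q (r k) x x)))"
      by (simp add: lim_imp_Liminf)
  qed
  also have "\<dots> \<le> liminf (\<lambda>k. bump_integral (q (r k)))"
    unfolding bump_integral_def
  proof (rule nn_integral_liminf)
    fix k
    note [measurable] = measurable_frame_form[OF qf[of "r k"]]
    show "(\<lambda>x. ennreal (bump (q (r k) x x))) \<in> borel_measurable vol" by measurable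
  qed
  also have "\<dots> = K * v"
  proof (rule lim_imp_Liminf)
    have "(\<lambda>k. unit_volume (q (r k))) \<longlonglongrightarrow> v" using LIMSEQ_subseq_LIMSEQ[OF Vq r] by (simp add: o_def)
    then show "(\<lambda>k. bump_integral (q (r k))) \<longlonglongrightarrow> K * v"
      unfolding K(3)[OF qf] using K(2) by (intro ennreal_tendsto_cmult) auto
  qed simp
  finally have "K * unit_volume p \<le> K * v" by (simp add: K(3)[OF pf])
  then have Vp: "unit_volume p \<le> v" using K(1,2) by (subst (asm) ennreal_mult_le_mult_iff) auto
  have v_le: "v \<le> unit_volume q" if "q \<in> P" for q unfolding v_def using that by (intro Inf_lower) auto
  show thesis
  proof (rule that[OF pf pN])
    show "unit_volume p < \<infinity>" using Vp v_le[OF \<open>p0 \<in> P\<close>] p0(3) by (meson le_less_trans order_trans)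
    show "unit_volume p \<le> unit_volume q" if "frame_form q" "\<And>x. x \<in> span (e ` I) \<Longrightarrow> q x x \<le> N x" for q
      using Vp v_le[of q] that by (auto simp: P_def)
  qed
qed

text \<open>Equivalence of norms in finite dimension, from compactness of the coordinate sphere. It is applied to
  the norm of the ambient space, which gives one enclosing ellipsoid, and to the norm of an ellipsoid,
  which shows that functionals are bounded on it.\<close>

lemma euclidean_form_le_seminorm:
  fixes N :: "'a \<Rightarrow> real"
  assumes cont: "continuous_on UNIV (\<lambda>c. N (lincomb c))"
    and hom: "\<And>r x. x \<in> span (e ` I) \<Longrightarrow> N (r *\<^sub>R x) = \<bar>r\<bar> * N x"
    and pos: "\<And>x. x \<in> span (e ` I) \<Longrightarrow> x \<noteq> 0 \<Longrightarrow> 0 < N x"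
  obtains K where "0 < K" "\<And>x. x \<in> span (e ` I) \<Longrightarrow> euclidean_form x x \<le> K * (N x)\<^sup>2"
proof -
  define C where "C = Pi\<^sub>E UNIV (\<lambda>i. if i \<in> I then {-1..1::real} else {0})"
  define S where "S = C \<inter> {c. (\<Sum>i\<in>I. (c i)\<^sup>2) = 1}"
  have "compactin (product_topology (\<lambda>i. euclidean) UNIV) C"
    unfolding C_def by (subst compactin_PiE) auto
  then have "compact C" by (simp add: euclidean_product_topology)
  moreover have "closed {c. (\<Sum>i\<in>I. (c i)\<^sup>2) = (1::real)}"
    by (intro closed_Collect_eq continuous_intros continuous_on_product_coordinates)
  ultimately have S: "compact S" unfolding S_def by (rule compact_Int_closed)
  have unit: "\<exists>c\<in>S. x = sqrt (euclidean_form x x) *\<^sub>R lincomb c" if x: "x \<in> span (e ` I)" and E: "euclidean_form x x > 0" for x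
  proof
    let ?s = "sqrt (euclidean_form x x)"
    let ?c = "\<lambda>i. if i \<in> I then g i x / ?s else 0"
    have s: "?s > 0" using E by simp
    have "(\<Sum>i\<in>I. (?c i)\<^sup>2) = (\<Sum>i\<in>I. g i x * g i x / euclidean_form x x)"
      using E by (intro sum.cong) (auto simp: power_divide power2_eq_square)
    also have "\<dots> = 1" using E by (simp add: sum_divide_distrib[symmetric] euclidean_form_def)
    finally have sum1: "(\<Sum>i\<in>I. (?c i)\<^sup>2) = 1" .
    have "\<bar>?c i\<bar> \<le> 1" if "i \<in> I" for i
    proof -
      have "(?c i)\<^sup>2 \<le> (\<Sum>i\<in>I. (?c i)\<^sup>2)"
        using that finite_index by (intro member_le_sum[where f = "\<lambda>i. (?c i)\<^sup>2"]) auto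
      then show ?thesis using sum1 by (simp add: abs_square_le_1)
    qed
    then have "?c i \<in> {-1..1}" if "i \<in> I" for i
      using that by (simp only: abs_le_iff atLeastAtMost_iff minus_le_iff)
    then show "?c \<in> S" using sum1 by (auto simp: S_def C_def)
    have "?s *\<^sub>R lincomb ?c = lincomb (\<lambda>i. ?s * ?c i)" by (rule lincomb_cmul[symmetric])
    also have "\<dots> = proj x" unfolding proj_def using s by (intro lincomb_cong) auto
    also have "\<dots> = x" by (rule proj_span[OF x])
    finally show "x = ?s *\<^sub>R lincomb ?c" ..
  qed
  show thesis
  proof (cases "S = {}")
    case True
    have "euclidean_form x x \<le> 1 * (N x)\<^sup>2" if "x \<in> span (e ` I)" for x
    proof -
      have "euclidean_form x x \<le> 0" using unit[OF that] True by (meson empty_iff not_le)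
      then show ?thesis by (simp add: order_trans)
    qed
    then show thesis using that[of 1] by auto
  next
    case False
    obtain c1 where c1: "c1 \<in> S" "\<And>c. c \<in> S \<Longrightarrow> N (lincomb c1) \<le> N (lincomb c)"
      using continuous_attains_inf[OF S False continuous_on_subset[OF cont]] by auto
    define d where "d = N (lincomb c1)"
    have "lincomb c1 \<noteq> 0"
    proof
      assume "lincomb c1 = 0"
      then have "c1 i = 0" if "i \<in> I" for i
        using coord_lincomb[OF that, of c1] linear_0[OF linear_coord[of i]] by simp
      then show False using c1(1) by (simp add: S_def)
    qed
    then have d: "d > 0" unfolding d_def by (intro pos) auto
    have "euclidean_form x x \<le> (1 / d\<^sup>2) * (N x)\<^sup>2" if x: "x \<in> span (e ` I)" for x
    proof (cases "euclidean_form x x > 0")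
      case True
      from unit[OF x True] obtain c where c: "c \<in> S" "x = sqrt (euclidean_form x x) *\<^sub>R lincomb c" by blast
      have "N x = sqrt (euclidean_form x x) * N (lincomb c)"
        using True by (subst c(2)) (simp add: hom)
      then have "sqrt (euclidean_form x x) * d \<le> N x"
        using c1(2)[OF c(1)] True by (simp add: d_def)
      then have "(sqrt (euclidean_form x x) * d)\<^sup>2 \<le> (N x)\<^sup>2"
        using d True by (intro power_mono) auto
      then show ?thesis using d True by (simp add: power_mult_distrib field_simps)
    next
      case False
      then have "euclidean_form x x \<le> 0" by simp
      also have "0 \<le> (1 / d\<^sup>2) * (N x)\<^sup>2" by simp
      finally show ?thesis .
    qed
    then show thesis using that[of "1 / d\<^sup>2"] d by auto
  qed
qed

end

section \<open>Minimum volume ellipsoids\<close>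

lemma subspace_basis_frame:
  fixes E :: "'a::real_vector set"
  assumes "fin_dim_subspace E"
  obtains g where "coordinate_frame (subspace_basis E) (\<lambda>b. b) g" "span (subspace_basis E) = E"
proof -
  obtain B0 where B0: "finite B0" "span B0 = E" using assms unfolding fin_dim_subspace_def by blast
  obtain B1 where B1: "B1 \<subseteq> B0" "independent B1" "B0 \<subseteq> span B1" "card B1 = dim B0"
    by (rule basis_exists)
  have "span B1 = E"
    using B1 B0 span_mono[OF B1(1)] span_minimal[OF B1(3) subspace_span] by auto
  with B1 have "independent (subspace_basis E) \<and> span (subspace_basis E) = E"
    unfolding subspace_basis_def by (intro someI[where P = "\<lambda>B. independent B \<and> span B = E"]) auto
  then have B: "independent (subspace_basis E)" "span (subspace_basis E) = E" by auto
  have "subspace_basis E \<subseteq> span B0" using B(2) B0(2) span_superset by blast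
  then have fin: "finite (subspace_basis E)"
    using independent_span_bound[OF B0(1) B(1)] by auto
  have "\<exists>g :: 'a \<Rightarrow> real. linear g \<and> (\<forall>x\<in>subspace_basis E. g x = (if b = x then 1 else 0))" for b
    by (rule linear_independent_extend[OF B(1)])
  then obtain g where g: "\<And>b. linear (g b :: 'a \<Rightarrow> real)"
    "\<And>b x. x \<in> subspace_basis E \<Longrightarrow> g b x = (if b = x then 1 else 0)" by metis
  show thesis
  proof (rule that[OF _ B(2)])
    show "coordinate_frame (subspace_basis E) (\<lambda>b. b) g"
      by (rule coordinate_frame.intro) (use fin g in auto)
  qed
qed

text \<open>The connection between the volume of a subspace in arbitrarily chosen coordinates and the measures on
  the whole space: the set \<open>A \<inter> E\<close> need not be measurable, but \<open>A\<close> is.\<close>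

lemma subspace_volume_eq:
  assumes frame: "coordinate_frame (subspace_basis E) (\<lambda>b. b) g" and span: "span (subspace_basis E) = E"
    and A: "A \<in> sets functional_algebra"
  shows "subspace_volume E (A \<inter> E) = emeasure (coordinate_frame.vol (subspace_basis E) (\<lambda>b. b)) A"
proof -
  interpret coordinate_frame "subspace_basis E" "\<lambda>b. b" g by fact
  have "lincomb c \<in> E" for c using lincomb_in_span[of c] span by simp
  then show ?thesis
    by (simp add: subspace_volume_def Let_def emeasure_vol[OF A] lincomb_def)
qed

lemma ball_subset_ellipsoid_iff:
  fixes q :: "'a::real_normed_vector \<Rightarrow> 'a \<Rightarrow> real"
  assumes q: "psd_form q" and E: "subspace E"
  shows "cball 0 1 \<inter> E \<subseteq> {x \<in> E. q x x \<le> 1} \<longleftrightarrow> (\<forall>x\<in>E. q x x \<le> (norm x)\<^sup>2)"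
proof (intro iffI ballI subsetI)
  fix x assume sub: "cball 0 1 \<inter> E \<subseteq> {x \<in> E. q x x \<le> 1}" and x: "x \<in> E"
  show "q x x \<le> (norm x)\<^sup>2"
  proof (cases "x = 0")
    case True
    then show ?thesis by (simp add: psd_form_0[OF q])
  next
    case False
    define y where "y = (1 / norm x) *\<^sub>R x"
    have "y \<in> cball 0 1 \<inter> E" using x False E by (simp add: y_def subspace_scale)
    then have "q y y \<le> 1" using sub by blast
    then show ?thesis using False
      by (simp add: y_def psd_form_scale[OF q] divide_simps power2_eq_square)
  qed
next
  fix x assume le: "\<forall>x\<in>E. q x x \<le> (norm x)\<^sup>2" and "x \<in> cball 0 1 \<inter> E"
  then have "x \<in> E" "(norm x)\<^sup>2 \<le> 1" by (auto simp: power_le_one)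
  then show "x \<in> {x \<in> E. q x x \<le> 1}" using le by fastforce
qed

abbreviation enclosing_ellipsoid :: "'a::real_normed_vector set \<Rightarrow> 'a set \<Rightarrow> bool" where
  "enclosing_ellipsoid E S \<equiv> ellipsoid_in E S \<and> cball 0 1 \<inter> E \<subseteq> S"

text \<open>The Loewner ellipsoid. An ellipsoid encloses the unit ball of the subspace exactly when its quadratic
  form is bounded by the squared norm, a condition which is stable under limits and means of forms.
  Existence and uniqueness of the minimising form then give those of the ellipsoid.\<close>

theorem minimum_volume_ellipsoid_unique:
  fixes E :: "'a::real_normed_vector set"
  assumes "fin_dim_subspace E"
  shows "\<exists>!S. is_arg_min (subspace_volume E) (enclosing_ellipsoid E) S"
proof -
  obtain g where frame: "coordinate_frame (subspace_basis E) (\<lambda>b. b) g" and span: "span (subspace_basis E) = E"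
    by (rule subspace_basis_frame[OF assms])
  interpret coordinate_frame "subspace_basis E" "\<lambda>b. b" g by (rule frame)
  have E: "span ((\<lambda>b. b) ` subspace_basis E) = E" by (simp add: span)
  have sub: "subspace E" using subspace_span[of "subspace_basis E"] by (simp add: span)
  have ball: "cball 0 1 \<inter> E \<subseteq> {x \<in> E. q x x \<le> 1} \<longleftrightarrow> (\<forall>x\<in>E. q x x \<le> (norm x)\<^sup>2)" if "frame_form q" for q
    by (rule ball_subset_ellipsoid_iff[OF frame_form_psd[OF that] sub])
  have vol_ellipsoid: "subspace_volume E {x \<in> E. q x x \<le> 1} = unit_volume q" if "frame_form q" for q
    using subspace_volume_eq[OF frame span sublevel_measurable[OF that, of 1]]
    by (simp add: unit_volume_def Collect_conj_eq Int_commute)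
  have enclosing: "\<exists>q. frame_form q \<and> S = {x \<in> E. q x x \<le> 1} \<and> (\<forall>x\<in>E. q x x \<le> (norm x)\<^sup>2)"
    if S: "enclosing_ellipsoid E S" for S
  proof -
    obtain ip where ip: "inner_product_on E ip" "S = {x \<in> E. ip x x \<le> 1}"
      using S unfolding ellipsoid_in_def by blast
    obtain q where q: "frame_form q" "\<And>x y. x \<in> E \<Longrightarrow> y \<in> E \<Longrightarrow> q x y = ip x y"
      "{x \<in> E. ip x x \<le> 1} = {x. q x x \<le> 1} \<inter> E"
      by (rule inner_product_ellipsoid[unfolded E, OF ip(1)]) blast
    have "S = {x \<in> E. q x x \<le> 1}" using ip(2) q(3) by auto
    then show ?thesis using q(1) ball[OF q(1)] S by blast
  qed
  obtain K where K: "0 < K" "\<And>x. x \<in> E \<Longrightarrow> euclidean_form x x \<le> K * (norm x)\<^sup>2"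
  proof (rule euclidean_form_le_seminorm[where N = norm, unfolded E])
    show "continuous_on UNIV (\<lambda>c. norm (lincomb c))"
      unfolding lincomb_def by (intro continuous_intros continuous_on_product_coordinates)
  qed auto
  define p0 where "p0 = (\<lambda>x y. euclidean_form x y / K)"
  have p0: "frame_form p0"
    using frame_form_euclidean K(1) unfolding frame_form_def psd_form_def p0_def
    by (auto simp: add_divide_distrib)
  have p0_le: "p0 x x \<le> (norm x)\<^sup>2" if "x \<in> E" for x
    using K(2)[OF that] K(1) by (simp add: p0_def divide_simps mult.commute)
  have "unit_volume p0 < \<infinity>"
    using euclidean_ball_finite[of K] K(1) by (simp add: unit_volume_def p0_def)
  obtain p where p: "frame_form p" "\<And>x. x \<in> E \<Longrightarrow> p x x \<le> (norm x)\<^sup>2" "unit_volume p < \<infinity>"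
    and min: "\<And>q. frame_form q \<Longrightarrow> (\<And>x. x \<in> E \<Longrightarrow> q x x \<le> (norm x)\<^sup>2) \<Longrightarrow> unit_volume p \<le> unit_volume q"
    by (rule minimal_form_exists[of p0 "\<lambda>x. (norm x)\<^sup>2", unfolded E, OF p0 p0_le \<open>unit_volume p0 < \<infinity>\<close>]) blast+
  define S0 where "S0 = {x \<in> E. p x x \<le> 1}"
  have "inner_product_on E p" by (rule frame_form_inner_product[OF p(1,3), unfolded E])
  then have S0: "enclosing_ellipsoid E S0"
    using ball[OF p(1)] p(2) unfolding ellipsoid_in_def S0_def by blast
  have "is_arg_min (subspace_volume E) (enclosing_ellipsoid E) S0"
    unfolding is_arg_min_def
  proof (intro conjI S0[THEN conjunct1] S0[THEN conjunct2] notI)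
    assume "\<exists>S. enclosing_ellipsoid E S \<and> subspace_volume E S < subspace_volume E S0"
    then obtain S where S: "enclosing_ellipsoid E S" "subspace_volume E S < subspace_volume E S0" by blast
    obtain q where q: "frame_form q" "S = {x \<in> E. q x x \<le> 1}" "\<forall>x\<in>E. q x x \<le> (norm x)\<^sup>2"
      using enclosing[OF S(1)] by blast
    have "unit_volume q < unit_volume p"
      using S(2) by (simp add: q(2) S0_def vol_ellipsoid[OF q(1)] vol_ellipsoid[OF p(1)])
    moreover have "unit_volume p \<le> unit_volume q" using min[OF q(1)] q(3) by blast
    ultimately show False by simp
  qed
  moreover have "S = S0" if S: "is_arg_min (subspace_volume E) (enclosing_ellipsoid E) S" for S
  proof -
    obtain q where q: "frame_form q" "S = {x \<in> E. q x x \<le> 1}" "\<forall>x\<in>E. q x x \<le> (norm x)\<^sup>2"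
      using enclosing[of S] S unfolding is_arg_min_def by blast
    have "\<not> subspace_volume E S0 < subspace_volume E S"
      using S S0 unfolding is_arg_min_def by blast
    then have "unit_volume q \<le> unit_volume p"
      by (simp add: q(2) S0_def vol_ellipsoid[OF q(1)] vol_ellipsoid[OF p(1)])
    moreover have "unit_volume p \<le> unit_volume q" using min[OF q(1)] q(3) by blast
    ultimately have eq: "unit_volume p = unit_volume q" by (rule antisym[rotated])
    have m: "frame_form (\<lambda>x y. (p x y + q x y) / 2)"
      using p(1) q(1) unfolding frame_form_def psd_form_def by (auto simp: field_simps)
    have "unit_volume p \<le> unit_volume (\<lambda>x y. (p x y + q x y) / 2)"
    proof (rule min[OF m])
      fix x assume "x \<in> E"
      then have "p x x \<le> (norm x)\<^sup>2" "q x x \<le> (norm x)\<^sup>2" using p(2) q(3) by auto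
      then show "(p x x + q x x) / 2 \<le> (norm x)\<^sup>2" by simp
    qed
    from minimal_form_unique[OF p(1) q(1) eq p(3) this] show "S = S0"
      by (simp add: q(2) S0_def)
  qed
  ultimately show ?thesis by blast
qed

lemma min_vol_ellipsoid_arg_min:
  assumes "fin_dim_subspace E"
  shows "is_arg_min (subspace_volume E) (enclosing_ellipsoid E) (min_vol_ellipsoid E)"
  unfolding min_vol_ellipsoid_def by (rule theI'[OF minimum_volume_ellipsoid_unique[OF assms]])

lemma min_vol_ellipsoid_eqI:
  assumes "fin_dim_subspace E" "is_arg_min (subspace_volume E) (enclosing_ellipsoid E) S"
  shows "min_vol_ellipsoid E = S"
  using minimum_volume_ellipsoid_unique[OF assms(1)] min_vol_ellipsoid_arg_min[OF assms(1)] assms(2)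
  by blast

lemma fin_dim_subspace_linear_image:
  assumes "linear T" "fin_dim_subspace E"
  shows "fin_dim_subspace (T ` E)"
proof -
  obtain B where "finite B" "span B = E" using assms(2) unfolding fin_dim_subspace_def by blast
  then have "finite (T ` B)" "span (T ` B) = T ` E"
    using linear_span_image[OF assms(1), of B] by auto
  then show ?thesis unfolding fin_dim_subspace_def by blast
qed

lemma fin_dim_subspaceD: "fin_dim_subspace E \<Longrightarrow> subspace E"
  unfolding fin_dim_subspace_def by auto

lemma inner_product_on_pullback:
  assumes ip: "inner_product_on E ip" and T: "linear T" "linear T'" "\<And>x. T' (T x) = x"
  shows "inner_product_on (T ` E) (\<lambda>y z. ip (T' y) (T' z))"
proof -
  have "T x \<noteq> 0 \<Longrightarrow> x \<noteq> 0" for x using linear_0[OF T(1)] by auto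
  then show ?thesis
    using ip unfolding inner_product_on_def
    by (simp add: T(3) linear_add[OF T(2)] linear_cmul[OF T(2)])
qed

text \<open>The image under the linear map of the chosen basis of \<open>E\<close> is a basis of the image subspace, and in
  this basis the image of a set has the same coordinates as the set. Passing to the basis chosen for
  the image subspace costs a constant factor.\<close>

lemma subspace_volume_linear_image:
  fixes T :: "'a::real_vector \<Rightarrow> 'b::real_vector"
  assumes E: "fin_dim_subspace E" and T: "linear T" "linear T'" "\<And>x. T' (T x) = x"
  obtains c where "0 < c" "c < \<infinity>"
    "\<And>S. ellipsoid_in E S \<Longrightarrow> subspace_volume (T ` E) (T ` S) = c * subspace_volume E S"
proof -
  let ?B = "subspace_basis E" and ?B' = "subspace_basis (T ` E)"
  obtain g where F: "coordinate_frame ?B (\<lambda>b. b) g" and spanB: "span ?B = E"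
    by (rule subspace_basis_frame[OF E])
  obtain g' where G: "coordinate_frame ?B' (\<lambda>b. b) g'" and spanB': "span ?B' = T ` E"
    by (rule subspace_basis_frame[OF fin_dim_subspace_linear_image[OF T(1) E]])
  interpret F: coordinate_frame ?B "\<lambda>b. b" g by (rule F)
  interpret G: coordinate_frame ?B' "\<lambda>b. b" g' by (rule G)
  have TF: "coordinate_frame ?B T (\<lambda>b y. g b (T' y))"
  proof (rule coordinate_frame.intro)
    show "linear (\<lambda>y. g b (T' y))" for b
      using linear_compose[OF T(2) F.linear_coord[of b]] by (simp add: o_def)
  qed (use F.finite_index F.coord_e in \<open>auto simp: T(3)\<close>)
  interpret TF: coordinate_frame ?B T "\<lambda>b y. g b (T' y)" by (rule TF)
  have spanT: "span (T ` ?B) = T ` E" by (simp add: linear_span_image[OF T(1)] spanB)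
  obtain c where c: "0 < c" "c < \<infinity>"
    "\<And>A. A \<in> sets functional_algebra \<Longrightarrow> emeasure G.vol A = c * emeasure TF.vol A"
    by (rule coordinate_frames_proportional[OF G TF]) (simp add: spanT spanB', blast)
  show thesis
  proof (rule that[OF c(1,2)])
    fix S assume "ellipsoid_in E S"
    then obtain ip where ip: "inner_product_on E ip" "S = {x \<in> E. ip x x \<le> 1}"
      unfolding ellipsoid_in_def by blast
    have spanG: "span ((\<lambda>b. b) ` ?B') = T ` E" by (simp add: spanB')
    have pullback: "inner_product_on (T ` E) (\<lambda>y z. ip (T' y) (T' z))"
      by (rule inner_product_on_pullback[OF ip(1) T])
    obtain q where q: "G.frame_form q"
      "\<And>y z. y \<in> T ` E \<Longrightarrow> z \<in> T ` E \<Longrightarrow> q y z = ip (T' y) (T' z)"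
      "{y \<in> T ` E. ip (T' y) (T' y) \<le> 1} = {y. q y y \<le> 1} \<inter> T ` E"
      by (rule G.inner_product_ellipsoid[unfolded spanG, OF pullback]) blast
    have TS: "T ` S = {y. q y y \<le> 1} \<inter> T ` E"
      unfolding q(3)[symmetric] ip(2) by (auto simp: T(3))
    have mem: "TF.lincomb c \<in> {y. q y y \<le> 1} \<longleftrightarrow> F.lincomb c \<in> S" for c
    proof -
      have lin: "TF.lincomb c = T (F.lincomb c)"
        by (simp add: TF.lincomb_def F.lincomb_def linear_sum[OF T(1)] linear_cmul[OF T(1)])
      have E: "F.lincomb c \<in> E" using F.lincomb_in_span[of c] by (simp add: spanB)
      have "F.lincomb c \<in> S \<longleftrightarrow> T (F.lincomb c) \<in> T ` S" using T(3) by (metis image_iff)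
      also have "\<dots> \<longleftrightarrow> T (F.lincomb c) \<in> {y. q y y \<le> 1}" unfolding TS using E by simp
      finally show ?thesis unfolding lin ..
    qed
    have "subspace_volume (T ` E) (T ` S) = c * emeasure TF.vol {y. q y y \<le> 1}"
      unfolding TS using G.sublevel_measurable[OF q(1), of 1]
      by (simp add: subspace_volume_eq[OF G spanB'] c(3))
    also have "emeasure TF.vol {y. q y y \<le> 1} = subspace_volume E S"
      using G.sublevel_measurable[OF q(1), of 1]
      by (simp only: TF.emeasure_vol mem) (simp add: subspace_volume_def Let_def F.lincomb_def)
    finally show "subspace_volume (T ` E) (T ` S) = c * subspace_volume E S" .
  qed
qed

lemma isometry_group_inverse:
  assumes "T \<in> isometry_group"
  obtains T' where "T' \<in> isometry_group" "\<And>x. T' (T x) = x" "\<And>x. T (T' x) = x"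
proof -
  have T: "linear T" "surj T" "\<And>x. norm (T x) = norm x" using assms by (auto simp: isometry_group_def)
  have "inj T"
  proof (rule injI)
    fix x y assume "T x = T y"
    then have "norm (T (x - y)) = 0" by (simp add: linear_diff[OF T(1)])
    then show "x = y" by (simp add: T(3))
  qed
  then have inv: "\<And>x. inv T (T x) = x" "\<And>x. T (inv T x) = x" using T(2) by (auto simp: surj_f_inv_f)
  have "linear (inv T)"
  proof (rule linearI)
    show "inv T (x + y) = inv T x + inv T y" for x y
      using inv(1)[of "inv T x + inv T y"] by (simp add: linear_add[OF T(1)] inv(2))
    show "inv T (r *\<^sub>R x) = r *\<^sub>R inv T x" for r x
      using inv(1)[of "r *\<^sub>R inv T x"] by (simp add: linear_cmul[OF T(1)] inv(2))
  qed
  moreover have "surj (inv T)" using inv(1) by (metis surjI)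
  moreover have "norm (inv T x) = norm x" for x using T(3)[of "inv T x"] inv(2) by simp
  ultimately have "inv T \<in> isometry_group" by (simp add: isometry_group_def)
  then show thesis using that inv by blast
qed

lemma enclosing_ellipsoid_isometry:
  assumes T: "T \<in> isometry_group" and E: "fin_dim_subspace E" and S: "enclosing_ellipsoid E S"
  shows "enclosing_ellipsoid (T ` E) (T ` S)"
proof
  obtain T' where T': "T' \<in> isometry_group" "\<And>x. T' (T x) = x" "\<And>x. T (T' x) = x"
    by (rule isometry_group_inverse[OF T]) blast
  have norm: "norm (T x) = norm x" for x using T by (simp add: isometry_group_def)
  obtain ip where ip: "inner_product_on E ip" "S = {x \<in> E. ip x x \<le> 1}"
    using S unfolding ellipsoid_in_def by blast
  have "linear T" "linear T'" using T T'(1) by (auto simp: isometry_group_def)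
  from inner_product_on_pullback[OF ip(1) this T'(2)]
  have "inner_product_on (T ` E) (\<lambda>y z. ip (T' y) (T' z))" .
  moreover have "T ` S = {y \<in> T ` E. ip (T' y) (T' y) \<le> 1}" using ip(2) T'(2) by auto
  ultimately show "ellipsoid_in (T ` E) (T ` S)"
    unfolding ellipsoid_in_def by blast
  show "cball 0 1 \<inter> T ` E \<subseteq> T ` S" using S norm by auto
qed

text \<open>An isometry maps enclosing ellipsoids of \<open>E\<close> to enclosing ellipsoids of its image and multiplies their
  volumes by a constant, and so does its inverse. It therefore preserves minimality, and uniqueness
  identifies the two minimal ellipsoids.\<close>

lemma min_vol_ellipsoid_isometry:
  assumes T: "T \<in> isometry_group" and E: "fin_dim_subspace E"
  shows "min_vol_ellipsoid (T ` E) = T ` min_vol_ellipsoid E"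
proof (rule min_vol_ellipsoid_eqI)
  obtain T' where T': "T' \<in> isometry_group" "\<And>x. T' (T x) = x" "\<And>x. T (T' x) = x"
    by (rule isometry_group_inverse[OF T]) blast
  have lin: "linear T" "linear T'" using T T'(1) by (auto simp: isometry_group_def)
  show TE: "fin_dim_subspace (T ` E)" by (rule fin_dim_subspace_linear_image[OF lin(1) E])
  obtain c where c: "0 < c" "c < \<infinity>"
    "\<And>S. ellipsoid_in E S \<Longrightarrow> subspace_volume (T ` E) (T ` S) = c * subspace_volume E S"
    by (rule subspace_volume_linear_image[OF E lin T'(2)]) blast
  let ?S = "min_vol_ellipsoid E"
  have S: "enclosing_ellipsoid E ?S" "\<And>S. enclosing_ellipsoid E S \<Longrightarrow> subspace_volume E ?S \<le> subspace_volume E S"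
    using min_vol_ellipsoid_arg_min[OF E] unfolding is_arg_min_linorder by auto
  show "is_arg_min (subspace_volume (T ` E)) (enclosing_ellipsoid (T ` E)) (T ` ?S)"
    unfolding is_arg_min_linorder
  proof (intro conjI allI impI)
    show "ellipsoid_in (T ` E) (T ` ?S)" "cball 0 1 \<inter> T ` E \<subseteq> T ` ?S"
      using enclosing_ellipsoid_isometry[OF T E S(1)] by auto
    fix S' assume S': "enclosing_ellipsoid (T ` E) S'"
    have "T' ` T ` E = E" by (simp add: image_image T')
    with enclosing_ellipsoid_isometry[OF T'(1) TE S'] have *: "enclosing_ellipsoid E (T' ` S')" by simp
    have "subspace_volume (T ` E) (T ` ?S) = c * subspace_volume E ?S" using c(3) S(1) by blast
    also have "\<dots> \<le> c * subspace_volume E (T' ` S')" using S(2)[OF *] by (rule mult_left_mono) simp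
    also have "\<dots> = subspace_volume (T ` E) (T ` T' ` S')" using c(3)[of "T' ` S'"] * by simp
    also have "T ` T' ` S' = S'" by (simp add: image_image T')
    finally show "subspace_volume (T ` E) (T ` ?S) \<le> subspace_volume (T ` E) S'" .
  qed
qed

lemma bounded_on_ellipsoid:
  fixes f :: "'a::real_vector \<Rightarrow> real"
  assumes E: "fin_dim_subspace E" and ip: "inner_product_on E ip" and f: "linear f"
  shows "bdd_above ((\<lambda>y. \<bar>f y\<bar>) ` {x \<in> E. ip x x \<le> 1})"
proof -
  obtain g where frame: "coordinate_frame (subspace_basis E) (\<lambda>b. b) g" and span: "span (subspace_basis E) = E"
    by (rule subspace_basis_frame[OF E])
  interpret coordinate_frame "subspace_basis E" "\<lambda>b. b" g by (rule frame)
  have span': "span ((\<lambda>b. b) ` subspace_basis E) = E" by (simp add: span)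
  obtain q where q: "frame_form q" "\<And>x y. x \<in> E \<Longrightarrow> y \<in> E \<Longrightarrow> q x y = ip x y"
    "{x \<in> E. ip x x \<le> 1} = {x. q x x \<le> 1} \<inter> E"
    by (rule inner_product_ellipsoid[unfolded span', OF ip]) blast
  note psd = frame_form_psd[OF q(1)]
  obtain K where K: "0 < K" "\<And>x. x \<in> E \<Longrightarrow> euclidean_form x x \<le> K * (sqrt (q x x))\<^sup>2"
  proof (rule euclidean_form_le_seminorm[where N = "\<lambda>x. sqrt (q x x)", unfolded span'])
    show "continuous_on UNIV (\<lambda>c. sqrt (q (lincomb c) (lincomb c)))"
      by (intro continuous_intros continuous_form_lincomb psd)
    show "sqrt (q (r *\<^sub>R x) (r *\<^sub>R x)) = \<bar>r\<bar> * sqrt (q x x)" for r x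
      by (simp add: psd_form_scale[OF psd] real_sqrt_mult mult.assoc[symmetric])
    show "0 < sqrt (q x x)" if "x \<in> E" "x \<noteq> 0" for x
      using ip that q(2) unfolding inner_product_on_def by auto
  qed auto
  show ?thesis
  proof (rule bdd_aboveI2)
    fix x assume "x \<in> {x \<in> E. ip x x \<le> 1}"
    then have x: "x \<in> E" "q x x \<le> 1" using q(2) by auto
    have "(sqrt (q x x))\<^sup>2 \<le> 1" using x(2) psd_form_nonneg[OF psd] by simp
    then have euc: "euclidean_form x x \<le> K"
      using K(2)[OF x(1)] K(1) by (smt (verit) mult_left_le)
    have gb: "\<bar>g b x\<bar> \<le> sqrt K" if "b \<in> subspace_basis E" for b
    proof (rule real_le_rsqrt)
      have "g b x * g b x \<le> (\<Sum>b\<in>subspace_basis E. g b x * g b x)"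
        using that finite_index by (intro member_le_sum) auto
      then show "\<bar>g b x\<bar>\<^sup>2 \<le> K" using euc by (simp add: euclidean_form_def power2_eq_square)
    qed
    have "x = (\<Sum>b\<in>subspace_basis E. g b x *\<^sub>R b)"
      using proj_span[unfolded span', OF x(1)] by (simp add: proj_def lincomb_def)
    then have "f x = f (\<Sum>b\<in>subspace_basis E. g b x *\<^sub>R b)" by (rule arg_cong)
    also have "\<dots> = (\<Sum>b\<in>subspace_basis E. g b x * f b)"
      by (simp add: linear_sum[OF f] linear_cmul[OF f])
    finally have "\<bar>f x\<bar> = \<bar>\<Sum>b\<in>subspace_basis E. g b x * f b\<bar>" by simp
    also have "\<dots> \<le> (\<Sum>b\<in>subspace_basis E. sqrt K * \<bar>f b\<bar>)"
      by (rule order_trans[OF sum_abs sum_mono]) (auto simp: abs_mult intro: mult_right_mono gb)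
    finally show "\<bar>f x\<bar> \<le> (\<Sum>b\<in>subspace_basis E. sqrt K * \<bar>f b\<bar>)" .
  qed
qed

text \<open>The supremum in \<^const>\<open>eta\<close> is a supremum of real numbers, so it is meaningful only after boundedness of
  the functional on the ellipsoid has been established.\<close>

lemma functional_le_eta:
  fixes f :: "'a::real_normed_vector \<Rightarrow>\<^sub>L real"
  assumes E: "fin_dim_subspace E" and ip: "inner_product_on E ip"
    and S: "min_vol_ellipsoid E = {x \<in> E. ip x x \<le> 1}" and y: "y \<in> E"
  shows "\<bar>blinfun_apply f y\<bar> \<le> eta f E * sqrt (ip y y)"
proof (cases "y = 0")
  case True
  have "ip y y = 0 * ip y y" using ip y True unfolding inner_product_on_def by (metis scale_zero_left)
  then show ?thesis using True by simp
next
  case False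
  then have pos: "ip y y > 0" using ip y unfolding inner_product_on_def by blast
  define z where "z = (1 / sqrt (ip y y)) *\<^sub>R y"
  have z: "z \<in> E" using y fin_dim_subspaceD[OF E] by (simp add: z_def subspace_scale)
  have scale: "ip (r *\<^sub>R y) (r *\<^sub>R y) = r * r * ip y y" for r
  proof -
    have ry: "r *\<^sub>R y \<in> E" using y by (rule subspace_scale[OF fin_dim_subspaceD[OF E]])
    have "ip (r *\<^sub>R y) (r *\<^sub>R y) = r * ip y (r *\<^sub>R y)"
      using ip y ry unfolding inner_product_on_def by blast
    also have "ip y (r *\<^sub>R y) = ip (r *\<^sub>R y) y"
      by (rule ip[unfolded inner_product_on_def, THEN conjunct1, rule_format, OF y ry])
    also have "\<dots> = r * ip y y"
      using ip y unfolding inner_product_on_def by blast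
    finally show ?thesis by simp
  qed
  have "ip z z = 1" using pos by (simp add: z_def scale)
  then have "z \<in> {x \<in> E. ip x x \<le> 1}" using z by simp
  then have "\<bar>f z\<bar> \<le> eta f E"
    unfolding eta_def S
    by (rule cSUP_upper[OF _ bounded_on_ellipsoid[OF E ip]])
       (simp add: blinfun.bounded_linear_right bounded_linear.linear)
  then show ?thesis using pos
    by (simp add: z_def blinfun.scaleR_right abs_mult field_simps)
qed

section \<open>The limit inner product\<close>

text \<open>Tychonoff's theorem for a family of uniformly bounded functions, in the form in which it is used: every
  closed condition that eventually holds along the filter holds at the cluster point.\<close>

lemma bounded_functions_cluster_point:
  fixes \<phi> :: "'e \<Rightarrow> 'i \<Rightarrow> real"
  assumes "L \<noteq> bot" and bound: "\<And>E i. \<bar>\<phi> E i\<bar> \<le> b i"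
  obtains c where "\<And>C. closed C \<Longrightarrow> eventually (\<lambda>E. \<phi> E \<in> C) L \<Longrightarrow> c \<in> C"
proof -
  define K where "K = Pi\<^sub>E UNIV (\<lambda>i. {- b i..b i})"
  have "compactin (product_topology (\<lambda>i. euclidean) UNIV) K"
    unfolding K_def by (subst compactin_PiE) auto
  then have K: "compact K" by (simp add: euclidean_product_topology)
  have "\<phi> E \<in> K" for E
    using bound[of E] by (auto simp: K_def abs_le_iff minus_le_iff)
  then have "eventually (\<lambda>c. c \<in> K) (filtermap \<phi> L)" by (simp add: eventually_filtermap)
  moreover have "filtermap \<phi> L \<noteq> bot" using assms(1) by (simp add: filtermap_bot_iff)
  ultimately obtain c where c: "inf (nhds c) (filtermap \<phi> L) \<noteq> bot"
    using K unfolding compact_filter by blast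
  have "c \<in> C" if C: "closed C" "eventually (\<lambda>E. \<phi> E \<in> C) L" for C
  proof (rule ccontr)
    assume "c \<notin> C"
    then have "eventually (\<lambda>x. x \<in> - C) (nhds c)" using C(1) by (intro eventually_nhds_in_open) auto
    moreover have "eventually (\<lambda>x. x \<in> C) (filtermap \<phi> L)" using C(2) by (simp add: eventually_filtermap)
    ultimately have "eventually (\<lambda>x. False) (inf (nhds c) (filtermap \<phi> L))"
      unfolding eventually_inf by (intro exI conjI) auto
    then show False using c by (simp add: trivial_limit_def)
  qed
  then show thesis by (rule that)
qed

text \<open>The tails of the directed set of finite-dimensional subspaces, over which the DES constant is a limit
  superior.\<close>

definition large_subspaces :: "'a::real_vector set filter" where
  "large_subspaces = (INF F\<in>{F. fin_dim_subspace F}. principal {E. fin_dim_subspace E \<and> F \<subseteq> E})"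

lemma fin_dim_subspace_span: "finite B \<Longrightarrow> fin_dim_subspace (span B)"
  unfolding fin_dim_subspace_def by blast

lemma eventually_large_subspaces:
  "eventually P (large_subspaces :: 'a::real_vector set filter) \<longleftrightarrow>
     (\<exists>F. fin_dim_subspace F \<and> (\<forall>E. fin_dim_subspace E \<longrightarrow> F \<subseteq> E \<longrightarrow> P E))"
proof -
  have "eventually P (large_subspaces :: 'a set filter) \<longleftrightarrow>
    (\<exists>F\<in>{F. fin_dim_subspace F}. eventually P (principal {E. fin_dim_subspace E \<and> F \<subseteq> E}))"
    unfolding large_subspaces_def
  proof (rule eventually_INF_base)
    show "{F :: 'a set. fin_dim_subspace F} \<noteq> {}" using fin_dim_subspace_span[of "{}"] by auto
    fix F G :: "'a set" assume "F \<in> {F. fin_dim_subspace F}" "G \<in> {F. fin_dim_subspace F}"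
    then obtain A B where "finite A" "span A = F" "finite B" "span B = G"
      unfolding fin_dim_subspace_def by blast
    then have "fin_dim_subspace (span (A \<union> B))" "F \<subseteq> span (A \<union> B)" "G \<subseteq> span (A \<union> B)"
      by (auto intro: fin_dim_subspace_span span_mono[THEN subsetD])
    then show "\<exists>x\<in>{F. fin_dim_subspace F}. principal {E. fin_dim_subspace E \<and> x \<subseteq> E}
        \<le> inf (principal {E. fin_dim_subspace E \<and> F \<subseteq> E}) (principal {E. fin_dim_subspace E \<and> G \<subseteq> E})"
      by (intro bexI[of _ "span (A \<union> B)"]) (auto simp: inf_principal)
  qed
  then show ?thesis by (auto simp: eventually_principal)
qed

lemma large_subspaces_neq_bot: "(large_subspaces :: 'a::real_vector set filter) \<noteq> bot"
  by (auto simp: trivial_limit_def eventually_large_subspaces)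

lemma eventually_contains_large_subspaces:
  assumes "finite B"
  shows "eventually (\<lambda>E. fin_dim_subspace E \<and> B \<subseteq> E) large_subspaces"
  unfolding eventually_large_subspaces
  using fin_dim_subspace_span[OF assms] span_superset[of B] by blast

lemma DES_const_lessE:
  assumes "DES_const f < ereal C"
  obtains F where "fin_dim_subspace F" "\<And>E. fin_dim_subspace E \<Longrightarrow> F \<subseteq> E \<Longrightarrow> eta f E \<le> C"
proof -
  obtain F where F: "fin_dim_subspace F" "(SUP E\<in>{E. fin_dim_subspace E \<and> F \<subseteq> E}. ereal (eta f E)) < ereal C"
    using assms unfolding DES_const_def INF_less_iff by blast
  have "eta f E \<le> C" if "fin_dim_subspace E" "F \<subseteq> E" for E
  proof -
    have "ereal (eta f E) \<le> (SUP E\<in>{E. fin_dim_subspace E \<and> F \<subseteq> E}. ereal (eta f E))"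
      using that by (intro SUP_upper) auto
    then show ?thesis using F(2) by (metis ereal_less_eq(3) less_imp_le order_trans)
  qed
  with F(1) show thesis by (rule that)
qed

text \<open>By equivariance of the minimal ellipsoid, the width of the ellipsoid of \<open>T(E)\<close> in direction \<open>f\<close> is
  the width of the ellipsoid of \<open>E\<close> in direction \<open>f \<circ> T\<close>.\<close>

lemma functional_isometry_le_eta:
  fixes f :: "'a::real_normed_vector \<Rightarrow>\<^sub>L real"
  assumes E: "fin_dim_subspace E" and ip: "inner_product_on E ip"
    and S: "min_vol_ellipsoid E = {x \<in> E. ip x x \<le> 1}" and y: "y \<in> E" and T: "T \<in> isometry_group"
  shows "\<bar>blinfun_apply f (T y)\<bar> \<le> eta f (T ` E) * sqrt (ip y y)"
proof -
  obtain T' where T': "T' \<in> isometry_group" "\<And>x. T' (T x) = x" "\<And>x. T (T' x) = x"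
    by (rule isometry_group_inverse[OF T]) blast
  have lin: "linear T" "linear T'" using T T'(1) by (auto simp: isometry_group_def)
  have "min_vol_ellipsoid (T ` E) = {x \<in> T ` E. ip (T' x) (T' x) \<le> 1}"
    unfolding min_vol_ellipsoid_isometry[OF T E] S using T'(2) by auto
  from functional_le_eta[OF fin_dim_subspace_linear_image[OF lin(1) E]
      inner_product_on_pullback[OF ip lin T'(2)] this, of "T y" f] y
  show ?thesis by (simp add: T'(2))
qed

definition loewner_product :: "'a::real_normed_vector set \<Rightarrow> 'a \<Rightarrow> 'a \<Rightarrow> real" where
  "loewner_product E =
     (SOME ip. inner_product_on E ip \<and> min_vol_ellipsoid E = {x \<in> E. ip x x \<le> 1})"

lemma loewner_product:
  assumes "fin_dim_subspace E"
  shows "inner_product_on E (loewner_product E)"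
    and "min_vol_ellipsoid E = {x \<in> E. loewner_product E x x \<le> 1}"
proof -
  have "\<exists>ip. inner_product_on E ip \<and> min_vol_ellipsoid E = {x \<in> E. ip x x \<le> 1}"
    using min_vol_ellipsoid_arg_min[OF assms] unfolding is_arg_min_def ellipsoid_in_def by blast
  from someI_ex[OF this] show "inner_product_on E (loewner_product E)"
    "min_vol_ellipsoid E = {x \<in> E. loewner_product E x x \<le> 1}"
    unfolding loewner_product_def by auto
qed

lemma inner_product_onD:
  assumes ip: "inner_product_on E ip" and E: "subspace E"
  shows inner_product_on_sym: "x \<in> E \<Longrightarrow> y \<in> E \<Longrightarrow> ip x y = ip y x"
    and inner_product_on_add: "x \<in> E \<Longrightarrow> y \<in> E \<Longrightarrow> z \<in> E \<Longrightarrow> ip (x + y) z = ip x z + ip y z"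
    and inner_product_on_scale: "x \<in> E \<Longrightarrow> y \<in> E \<Longrightarrow> ip (r *\<^sub>R x) y = r * ip x y"
    and inner_product_on_nonneg: "x \<in> E \<Longrightarrow> 0 \<le> ip x x"
proof -
  show "x \<in> E \<Longrightarrow> y \<in> E \<Longrightarrow> ip x y = ip y x"
    by (rule ip[unfolded inner_product_on_def, THEN conjunct1, rule_format])
  show "x \<in> E \<Longrightarrow> y \<in> E \<Longrightarrow> z \<in> E \<Longrightarrow> ip (x + y) z = ip x z + ip y z"
    by (rule ip[unfolded inner_product_on_def, THEN conjunct2, THEN conjunct1, rule_format])
  show scale: "ip (r *\<^sub>R x) y = r * ip x y" if "x \<in> E" "y \<in> E" for r x y
    by (rule ip[unfolded inner_product_on_def, THEN conjunct2, THEN conjunct2, THEN conjunct1, rule_format, OF that])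
  show "x \<in> E \<Longrightarrow> 0 \<le> ip x x"
  proof (cases "x = 0")
    case True
    then show "x \<in> E \<Longrightarrow> 0 \<le> ip x x" using scale[of 0 0 0] subspace_0[OF E] by simp
  next
    case False
    then show "x \<in> E \<Longrightarrow> 0 \<le> ip x x"
      using ip unfolding inner_product_on_def by (simp add: less_imp_le)
  qed
qed

lemma loewner_product_le_norm:
  assumes E: "fin_dim_subspace E" and x: "x \<in> E"
  shows "loewner_product E x x \<le> (norm x)\<^sup>2"
proof -
  let ?ip = "loewner_product E"
  note sub = fin_dim_subspaceD[OF E] and ip = loewner_product(1)[OF E]
  note ipD = inner_product_onD[OF ip sub]
  have scale: "?ip (r *\<^sub>R x) (r *\<^sub>R x) = r * (r * ?ip x x)" for r
  proof -
    have rx: "r *\<^sub>R x \<in> E" using x by (rule subspace_scale[OF sub])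
    have "?ip (r *\<^sub>R x) (r *\<^sub>R x) = r * ?ip x (r *\<^sub>R x)" by (rule ipD(3)[OF x rx])
    also have "?ip x (r *\<^sub>R x) = ?ip (r *\<^sub>R x) x" by (rule ipD(1)[OF x rx])
    also have "\<dots> = r * ?ip x x" by (rule ipD(3)[OF x x])
    finally show ?thesis .
  qed
  show ?thesis
  proof (cases "x = 0")
    case True
    then show ?thesis using scale[of 0] by simp
  next
    case False
    have "(1 / norm x) *\<^sub>R x \<in> cball 0 1 \<inter> E"
      using False x by (simp add: subspace_scale[OF sub])
    then have "(1 / norm x) *\<^sub>R x \<in> min_vol_ellipsoid E"
      using min_vol_ellipsoid_arg_min[OF E] unfolding is_arg_min_def by blast
    then have "(1 / norm x) * ((1 / norm x) * ?ip x x) \<le> 1"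
      using scale by (simp add: loewner_product(2)[OF E])
    then show ?thesis using False by (simp add: divide_simps power2_eq_square)
  qed
qed

text \<open>A cluster point of the inner products of the minimal ellipsoids as the subspace grows. The bound for
  \<open>f\<close> passes to \<open>f \<circ> T\<close> for every isometry \<open>T\<close>: if \<open>F\<close> is a subspace beyond which
  \<open>eta f\<close> is at most \<open>C\<close>, then \<open>T(E)\<close> contains \<open>F\<close> as soon as \<open>E\<close> contains the preimage of
  \<open>F\<close>. There is no reason for the limit form to be invariant under isometries, but it
  satisfies these bounds for all of them simultaneously. The constants \<open>C\<close> are quantified after the form
  because the isometric case needs all \<open>C > 1\<close> for one and the same form.\<close>

lemma limit_inner_product:
  fixes f :: "'a::real_normed_vector \<Rightarrow>\<^sub>L real"
  obtains p :: "'a \<Rightarrow> 'a \<Rightarrow> real" where "psd_form p" "\<And>x. p x x \<le> (norm x)\<^sup>2"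
    "\<And>C T y. 0 \<le> C \<Longrightarrow> DES_const f < ereal C \<Longrightarrow> T \<in> isometry_group \<Longrightarrow> \<bar>f (T y)\<bar>\<^sup>2 \<le> C\<^sup>2 * p y y"
proof -
  \<comment> \<open>Extended by zero to pairs outside \<open>E\<close>, so that all inner products become bounded
    functions on the same set of pairs.\<close>
  define \<phi> where "\<phi> = (\<lambda>E (x :: 'a, y). if fin_dim_subspace E \<and> x \<in> E \<and> y \<in> E then loewner_product E x y else 0)"
  have \<phi>: "\<phi> E (x, y) = loewner_product E x y" if "fin_dim_subspace E" "x \<in> E" "y \<in> E" for E x y
    using that by (simp add: \<phi>_def)
  define b where "b = (\<lambda>(x :: 'a, y). (norm (x + y))\<^sup>2 + (norm x)\<^sup>2 + (norm y)\<^sup>2)"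
  have bound: "\<bar>\<phi> E i\<bar> \<le> b i" for E i
  proof (cases i)
    case (Pair x y)
    show ?thesis
    proof (cases "fin_dim_subspace E \<and> x \<in> E \<and> y \<in> E")
      case True
      let ?ip = "loewner_product E"
      from True have E: "fin_dim_subspace E" and xy: "x \<in> E" "y \<in> E" by auto
      note sub = fin_dim_subspaceD[OF E]
      note ipD = inner_product_onD[OF loewner_product(1)[OF E] sub]
      have s: "x + y \<in> E" using xy by (rule subspace_add[OF sub])
      have "?ip (x + y) (x + y) = ?ip x (x + y) + ?ip y (x + y)" by (rule ipD(2)[OF xy s])
      also have "?ip x (x + y) = ?ip x x + ?ip x y"
        unfolding ipD(1)[OF xy(1) s] ipD(2)[OF xy xy(1)] ipD(1)[OF xy(2,1)] ..
      also have "?ip y (x + y) = ?ip x y + ?ip y y"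
        unfolding ipD(1)[OF xy(2) s] by (rule ipD(2)[OF xy xy(2)])
      finally have "2 * ?ip x y = ?ip (x + y) (x + y) - ?ip x x - ?ip y y" by simp
      then show ?thesis
        using ipD(4)[OF xy(1)] ipD(4)[OF xy(2)] ipD(4)[OF s]
          loewner_product_le_norm[OF E xy(1)] loewner_product_le_norm[OF E xy(2)] loewner_product_le_norm[OF E s]
        by (simp add: Pair \<phi>[OF E xy] b_def abs_le_iff)
    qed (auto simp: Pair \<phi>_def b_def)
  qed
  obtain c where c: "\<And>C. closed C \<Longrightarrow> eventually (\<lambda>E. \<phi> E \<in> C) large_subspaces \<Longrightarrow> c \<in> C"
    by (rule bounded_functions_cluster_point[where \<phi> = \<phi> and b = b, OF large_subspaces_neq_bot bound]) blast
  define p where "p = (\<lambda>x y. c (x, y))"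
  have eqI: "h c = k c" if "continuous_on UNIV h" "continuous_on UNIV k"
    "eventually (\<lambda>E. h (\<phi> E) = k (\<phi> E)) large_subspaces" for h k :: "('a \<times> 'a \<Rightarrow> real) \<Rightarrow> real"
    using c[of "{c. h c = k c}"] that by (simp add: closed_Collect_eq)
  have leI: "h c \<le> k c" if "continuous_on UNIV h" "continuous_on UNIV k"
    "eventually (\<lambda>E. h (\<phi> E) \<le> k (\<phi> E)) large_subspaces" for h k :: "('a \<times> 'a \<Rightarrow> real) \<Rightarrow> real"
    using c[of "{c. h c \<le> k c}"] that by (simp add: closed_Collect_le)
  have psd: "psd_form p"
    unfolding psd_form_def p_def
  proof (intro conjI allI)
    fix x y z :: 'a and r :: real
    have "eventually (\<lambda>E. fin_dim_subspace E \<and> {x, y, z} \<subseteq> E) large_subspaces"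
      by (rule eventually_contains_large_subspaces) simp
    then have ev: "eventually (\<lambda>E. fin_dim_subspace E \<and> subspace E \<and> x \<in> E \<and> y \<in> E \<and> z \<in> E
        \<and> x + y \<in> E \<and> r *\<^sub>R x \<in> E) large_subspaces"
      by eventually_elim (auto dest: fin_dim_subspaceD intro: subspace_add subspace_scale)
    show "c (x, y) = c (y, x)"
      by (rule eqI, intro continuous_on_product_coordinates, intro continuous_on_product_coordinates,
          rule eventually_mono[OF ev])
         (simp add: \<phi> inner_product_on_sym[OF loewner_product(1)])
    show "c (x + y, z) = c (x, z) + c (y, z)"
      by (rule eqI, intro continuous_on_product_coordinates,
          intro continuous_intros continuous_on_product_coordinates, rule eventually_mono[OF ev])
         (simp add: \<phi> inner_product_on_add[OF loewner_product(1)])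
    show "c (r *\<^sub>R x, y) = r * c (x, y)"
      by (rule eqI, intro continuous_on_product_coordinates,
          intro continuous_intros continuous_on_product_coordinates, rule eventually_mono[OF ev])
         (simp add: \<phi> inner_product_on_scale[OF loewner_product(1)])
    show "0 \<le> c (x, x)"
      by (rule leI, intro continuous_intros, intro continuous_on_product_coordinates, rule eventually_mono[OF ev])
         (simp add: \<phi> inner_product_on_nonneg[OF loewner_product(1)])
  qed
  have le: "p x x \<le> (norm x)\<^sup>2" for x
    unfolding p_def
  proof (rule leI)
    show "eventually (\<lambda>E. \<phi> E (x, x) \<le> (norm x)\<^sup>2) large_subspaces"
      using eventually_contains_large_subspaces[of "{x}", simplified]
      by eventually_elim (simp add: \<phi> loewner_product_le_norm)
  qed (intro continuous_intros continuous_on_product_coordinates)+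
  have ge: "\<bar>f (T y)\<bar>\<^sup>2 \<le> C\<^sup>2 * p y y"
    if C: "0 \<le> C" "DES_const f < ereal C" and T: "T \<in> isometry_group" for C T y
    unfolding p_def
  proof (rule leI)
    obtain F where F: "fin_dim_subspace F" "\<And>E. fin_dim_subspace E \<Longrightarrow> F \<subseteq> E \<Longrightarrow> eta f E \<le> C"
      by (rule DES_const_lessE[OF C(2)]) blast
    obtain T' where T': "T' \<in> isometry_group" "\<And>x. T' (T x) = x" "\<And>x. T (T' x) = x"
      by (rule isometry_group_inverse[OF T]) blast
    have lin: "linear T" "linear T'" using T T'(1) by (auto simp: isometry_group_def)
    have "eventually (\<lambda>E. fin_dim_subspace E \<and> T' ` F \<subseteq> E) large_subspaces"
      unfolding eventually_large_subspaces
      using fin_dim_subspace_linear_image[OF lin(2) F(1)] by blast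
    moreover have "eventually (\<lambda>E. fin_dim_subspace E \<and> {y} \<subseteq> E) large_subspaces"
      by (rule eventually_contains_large_subspaces) simp
    ultimately show "eventually (\<lambda>E. \<bar>f (T y)\<bar>\<^sup>2 \<le> C\<^sup>2 * \<phi> E (y, y)) large_subspaces"
    proof eventually_elim
      case (elim E)
      then have E: "fin_dim_subspace E" "y \<in> E" by auto
      let ?ip = "loewner_product E"
      have nn: "0 \<le> ?ip y y"
        by (rule inner_product_on_nonneg[OF loewner_product(1)[OF E(1)] fin_dim_subspaceD[OF E(1)] E(2)])
      have "F \<subseteq> T ` E"
      proof
        fix x assume "x \<in> F"
        then have "T' x \<in> E" using elim by auto
        then have "T (T' x) \<in> T ` E" by (rule imageI)
        then show "x \<in> T ` E" by (simp add: T'(3))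
      qed
      then have "eta f (T ` E) \<le> C"
        by (rule F(2)[OF fin_dim_subspace_linear_image[OF lin(1) E(1)]])
      then have "eta f (T ` E) * sqrt (?ip y y) \<le> C * sqrt (?ip y y)"
        using nn by (intro mult_right_mono) auto
      with functional_isometry_le_eta[OF E(1) loewner_product[OF E(1)] E(2) T, of f]
      have "\<bar>f (T y)\<bar> \<le> C * sqrt (?ip y y)" by simp
      then have "\<bar>f (T y)\<bar>\<^sup>2 \<le> (C * sqrt (?ip y y))\<^sup>2" by (rule power_mono) simp
      then show ?case using nn by (simp add: \<phi> E power_mult_distrib)
    qed
  qed (intro continuous_intros continuous_on_product_coordinates)+
  show thesis by (rule that[of p]) (fact psd le ge)+
qed

section \<open>Convex-transitive spaces with directionally Euclidean structure\<close>

text \<open>For a unit vector \<open>u\<close> the half-space where \<open>f\<close> is at most \<open>C sqrt (p u u)\<close> is closed, convex and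
  contains the orbit of \<open>u\<close>. By convex-transitivity it contains the unit ball, so the norm of \<open>f\<close>,
  which is \<open>1\<close>, is bounded by \<open>C sqrt (p u u)\<close>.\<close>

lemma norm_le_limit_form:
  fixes f :: "'a::real_normed_vector \<Rightarrow>\<^sub>L real"
  assumes ct: "convex_transitive TYPE('a)" and f: "norm f = 1" and p: "psd_form p" and C: "0 \<le> C"
    and ge: "\<And>T y. T \<in> isometry_group \<Longrightarrow> \<bar>f (T y)\<bar>\<^sup>2 \<le> C\<^sup>2 * p y y"
  shows "norm y \<le> C * sqrt (p y y)"
proof (cases "y = 0")
  case True
  then show ?thesis by (simp add: psd_form_0[OF p])
next
  case False
  define u where "u = (1 / norm y) *\<^sub>R y"
  define s where "s = C * sqrt (p u u)"
  have s: "0 \<le> s" using C psd_form_nonneg[OF p] by (simp add: s_def)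
  have u: "norm u = 1" using False by (simp add: u_def)
  have le: "\<bar>f (T u)\<bar> \<le> s" if "T \<in> isometry_group" for T
  proof (rule power2_le_imp_le[OF _ s])
    show "\<bar>f (T u)\<bar>\<^sup>2 \<le> s\<^sup>2"
      using ge[OF that, of u] psd_form_nonneg[OF p] by (simp add: s_def power_mult_distrib)
  qed
  define W where "W = {x. f x \<le> s}"
  have "convex W" unfolding W_def
    using convex_linear_vimage[of f "{..s}"]
    by (simp add: vimage_def blinfun.bounded_linear_right bounded_linear.linear)
  moreover have "{T u | T. T \<in> isometry_group} \<subseteq> W"
  proof
    fix x assume "x \<in> {T u | T. T \<in> isometry_group}"
    then obtain T where "T \<in> isometry_group" "x = T u" by blast
    then show "x \<in> W" using le[of T] by (simp add: W_def)
  qed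
  ultimately have "convex hull {T u | T. T \<in> isometry_group} \<subseteq> W" by (rule hull_minimal[rotated])
  moreover have "closed W" unfolding W_def
    by (intro closed_Collect_le continuous_intros)
  ultimately have "closure (convex hull {T u | T. T \<in> isometry_group}) \<subseteq> W" by (rule closure_minimal)
  then have ball: "cball 0 1 \<subseteq> W" using ct u unfolding convex_transitive_def by blast
  have "norm f \<le> s"
  proof (rule norm_blinfun_bound[OF s])
    fix x
    show "norm (f x) \<le> s * norm x"
    proof (cases "x = 0")
      case False
      have "f ((1 / norm x) *\<^sub>R x) \<le> s" "f ((- 1 / norm x) *\<^sub>R x) \<le> s"
        using ball False by (auto simp: W_def subset_iff)
      then show ?thesis using False
        by (simp add: blinfun.scaleR_right blinfun.minus_right field_simps abs_le_iff)
    qed simp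
  qed
  then have "1 \<le> s" by (simp add: f)
  also have "s = C * (sqrt (p y y) / norm y)"
    using False by (simp add: s_def u_def psd_form_scale[OF p] real_sqrt_divide real_sqrt_mult)
  finally show ?thesis using False by (simp add: field_simps)
qed

lemma psd_form_triangle:
  assumes p: "psd_form p"
  shows "sqrt (p (x + y) (x + y)) \<le> sqrt (p x x) + sqrt (p y y)"
proof -
  let ?a = "sqrt (p x x)" and ?b = "sqrt (p y y)"
  have nn: "0 \<le> p x x" "0 \<le> p y y" by (simp_all add: psd_form_nonneg[OF p])
  have cs: "p x y \<le> ?a * ?b"
  proof (cases "p y y = 0")
    case True
    then show ?thesis using psd_form_null_vector[OF p True, of x] by simp
  next
    case False
    then have y: "0 < p y y" using nn by simp
    define t where "t = p x y / p y y"
    have "0 \<le> p (x - t *\<^sub>R y) (x - t *\<^sub>R y)" by (rule psd_form_nonneg[OF p])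
    also have "\<dots> = p (x + (- t) *\<^sub>R y) (x + (- t) *\<^sub>R y)" by simp
    also have "\<dots> = p x x - 2 * t * p x y + t * t * p y y"
      using psd_form_sym[OF p, of y x] 
      by (simp only: psd_form_add[OF p] psd_form_scale[OF p]) (simp add: algebra_simps)
    also have "\<dots> = p x x - p x y * p x y / p y y"
      using y by (simp add: t_def field_simps)
    finally have "(p x y)\<^sup>2 \<le> p x x * p y y"
      using y by (simp add: field_simps power2_eq_square)
    then have "(p x y)\<^sup>2 \<le> (?a * ?b)\<^sup>2" using nn by (simp add: power_mult_distrib)
    then show ?thesis by (rule power2_le_imp_le) (use nn in simp)
  qed
  show ?thesis
  proof (rule real_le_lsqrt)
    have "p (x + y) (x + y) = p x x + 2 * p x y + p y y"
      using psd_form_sym[OF p, of y x] by (simp add: psd_form_add[OF p])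
    also have "\<dots> \<le> (?a + ?b)\<^sup>2"
      using cs nn by (simp add: power2_sum)
    finally show "p (x + y) (x + y) \<le> (?a + ?b)\<^sup>2" .
  qed (use nn in auto)
qed

lemma equivalent_inner_product_hilbert:
  fixes p :: "'a::banach \<Rightarrow> 'a \<Rightarrow> real"
  assumes p: "psd_form p" and le: "\<And>x. p x x \<le> (norm x)\<^sup>2" and C: "0 < C"
    and ge: "\<And>x. norm x \<le> C * sqrt (p x x)"
  shows "hilbert_inner_product p"
    and "Metric_space.mtopology UNIV (ip_dist p) = (euclidean :: 'a topology)"
proof -
  have pos: "0 < p x x" if "x \<noteq> 0" for x
  proof -
    have "0 < norm x" using that by simp
    also note ge[of x]
    finally show ?thesis using C by (simp add: zero_less_mult_iff)
  qed
  have dist_le: "ip_dist p x y \<le> dist x y" for x y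
    using real_sqrt_le_mono[OF le[of "x - y"]] by (simp add: ip_dist_def ip_norm_def dist_norm)
  have le_dist: "dist x y \<le> C * ip_dist p x y" for x y
    using ge[of "x - y"] by (simp add: ip_dist_def ip_norm_def dist_norm)
  have "Metric_space UNIV (ip_dist p)"
  proof
    show "0 \<le> ip_dist p x y" for x y
      by (simp add: ip_dist_def ip_norm_def psd_form_nonneg[OF p])
    show "ip_dist p x y = ip_dist p y x" for x y
    proof -
      have "p (x - y) (x - y) = p ((-1) *\<^sub>R (y - x)) ((-1) *\<^sub>R (y - x))" by simp
      also have "\<dots> = p (y - x) (y - x)" by (simp only: psd_form_scale[OF p])
      finally show ?thesis by (simp add: ip_dist_def ip_norm_def)
    qed
    show "ip_dist p x y = 0 \<longleftrightarrow> x = y" for x y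
      using pos[of "x - y"] psd_form_0(1)[OF p, of 0]
      by (cases "x = y") (simp_all add: ip_dist_def ip_norm_def)
    show "ip_dist p x z \<le> ip_dist p x y + ip_dist p y z" for x y z
      using psd_form_triangle[OF p, of "x - y" "y - z"] by (simp add: ip_dist_def ip_norm_def)
  qed
  then interpret M: Metric_space UNIV "ip_dist p" .
  show top: "M.mtopology = (euclidean :: 'a topology)"
  proof (rule topology_eq[THEN iffD2], intro allI)
    fix U :: "'a set"
    show "openin M.mtopology U \<longleftrightarrow> openin euclidean U"
    proof
      assume "openin M.mtopology U"
      then have U: "\<And>x. x \<in> U \<Longrightarrow> \<exists>r>0. M.mball x r \<subseteq> U" by (simp add: M.openin_mtopology)
      have "\<exists>r>0. ball x r \<subseteq> U" if xU: "x \<in> U" for x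
      proof -
        obtain r where "r > 0" "M.mball x r \<subseteq> U" using U[OF xU] by blast
        moreover have "ball x r \<subseteq> M.mball x r"
          by (auto intro: le_less_trans[OF dist_le])
        ultimately show ?thesis by blast
      qed
      then show "openin euclidean U" by (simp add: open_contains_ball)
    next
      assume "openin euclidean U"
      then have U: "\<And>x. x \<in> U \<Longrightarrow> \<exists>r>0. ball x r \<subseteq> U" by (simp add: open_contains_ball)
      have "\<exists>r>0. M.mball x r \<subseteq> U" if xU: "x \<in> U" for x
      proof -
        obtain r where r: "r > 0" "ball x r \<subseteq> U" using U[OF xU] by blast
        have "M.mball x (r / C) \<subseteq> ball x r"
        proof
          fix y assume "y \<in> M.mball x (r / C)"
          then have "C * ip_dist p x y < r" using C by (simp add: field_simps)
          then show "y \<in> ball x r" using le_dist[of x y] by simp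
        qed
        then show ?thesis using r C by (intro exI[of _ "r / C"]) auto
      qed
      then show "openin M.mtopology U" by (simp add: M.openin_mtopology)
    qed
  qed
  have "M.mcomplete"
    unfolding M.mcomplete_def
  proof (intro allI impI)
    fix \<sigma> :: "nat \<Rightarrow> 'a" assume \<sigma>: "M.MCauchy \<sigma>"
    have "Cauchy \<sigma>"
      unfolding Cauchy_def
    proof (intro allI impI)
      fix \<epsilon> :: real assume "0 < \<epsilon>"
      then have "0 < \<epsilon> / C" using C by simp
      then obtain N where N: "\<And>n n'. N \<le> n \<Longrightarrow> N \<le> n' \<Longrightarrow> ip_dist p (\<sigma> n) (\<sigma> n') < \<epsilon> / C"
        using \<sigma> unfolding M.MCauchy_def by blast
      have "dist (\<sigma> m) (\<sigma> n) < \<epsilon>" if "N \<le> m" "N \<le> n" for m n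
        using N[OF that] le_dist[of "\<sigma> m" "\<sigma> n"] C by (simp add: field_simps)
      then show "\<exists>M. \<forall>m\<ge>M. \<forall>n\<ge>M. dist (\<sigma> m) (\<sigma> n) < \<epsilon>" by blast
    qed
    then obtain x where "\<sigma> \<longlonglongrightarrow> x" using Cauchy_convergent convergent_def by blast
    then show "\<exists>x. limitin M.mtopology \<sigma> x sequentially" by (auto simp: top)
  qed
  moreover have "inner_product_on UNIV p"
    using p pos unfolding psd_form_def inner_product_on_def by auto
  ultimately show "hilbert_inner_product p" by (simp add: hilbert_inner_product_def)
qed

theorem theorem3p2:
  fixes f :: "'a::banach \<Rightarrow>\<^sub>L real"
  assumes "convex_transitive TYPE('a)"
    and "norm f = 1"
    and "has_DES f"
  shows "isomorphic_to_hilbert TYPE('a) \<and>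
    (has_lambda_DES 1 f \<longrightarrow> isometric_to_hilbert TYPE('a))"
proof -
  obtain p where p: "psd_form p" and le: "\<And>x. p x x \<le> (norm x)\<^sup>2"
    and ge: "\<And>C T y. 0 \<le> C \<Longrightarrow> DES_const f < ereal C \<Longrightarrow> T \<in> isometry_group \<Longrightarrow> \<bar>f (T y)\<bar>\<^sup>2 \<le> C\<^sup>2 * p y y"
    by (rule limit_inner_product[of f]) blast
  have lower: "norm x \<le> C * sqrt (p x x)" if "0 \<le> C" "DES_const f < ereal C" for C x
    by (rule norm_le_limit_form[OF assms(1,2) p that(1)]) (rule ge[OF that])
  obtain n :: nat where n: "DES_const f < ereal (real n)"
    using assms(3) unfolding has_DES_def by (auto simp: less_PInf_Ex_of_nat)
  \<comment> \<open>The summand \<open>1\<close> only serves to make the constant positive.\<close>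
  define C where "C = real n + 1"
  have "ereal (real n) \<le> ereal C" by (simp add: C_def)
  with n have "DES_const f < ereal C" by (rule less_le_trans)
  then have C: "0 < C" "\<And>x. norm x \<le> C * sqrt (p x x)" using lower[of C] by (auto simp: C_def)
  have H: "hilbert_inner_product p" "Metric_space.mtopology UNIV (ip_dist p) = (euclidean :: 'a topology)"
    by (rule equivalent_inner_product_hilbert[where p = p and C = C]; fact p le C)+
  have "homeomorphic_map euclidean (Metric_space.mtopology UNIV (ip_dist p)) id"
    unfolding H(2) by (simp add: homeomorphic_map_id)
  then have "isomorphic_to_hilbert TYPE('a)"
    unfolding isomorphic_to_hilbert_def using H(1) linear_id by blast
  moreover have "isometric_to_hilbert TYPE('a)" if "has_lambda_DES 1 f"
  proof -
    have DES: "DES_const f = ereal 1" using that by (simp add: has_lambda_DES_def)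
    \<comment> \<open>Every constant \<open>1 / z > 1\<close> is admissible in the lower bound.\<close>
    have "norm x \<le> sqrt (p x x)" for x
    proof (rule field_le_mult_one_interval)
      fix z :: real assume z: "0 < z" "z < 1"
      have "norm x \<le> (1 / z) * sqrt (p x x)"
        using z by (intro lower) (auto simp: DES field_simps)
      then show "z * norm x \<le> sqrt (p x x)" using z by (simp add: field_simps)
    qed
    moreover have "sqrt (p x x) \<le> norm x" for x
      using real_sqrt_le_mono[OF le[of x]] by simp
    ultimately have "ip_norm p (id x) = norm x" for x by (simp add: ip_norm_def antisym)
    then show ?thesis
      unfolding isometric_to_hilbert_def using H(1) linear_id bij_id by blast
  qed
  ultimately show ?thesis by blast
qed

end
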